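(* Let $X$ be a Banach space with the Point of Continuity Property (PCP). Then every non-trivial weak-Cauchy sequence in $X$ has a boundedly complete (s)-subsequence, i.e. a subsequence which is a boundedly complete basic sequence and an (s)-sequence.
   Context: $X$ has the PCP if every non-empty bounded closed subset $F$ of $X$ admits a point of continuity of the identity map from $F$ with the weak topology to $F$ with the norm topology. A sequence $(x_j)$ in $X$ is weak-Cauchy if $\lim_jx^*(x_j)$ exists for all $x^*\in X^*$; it is non-trivial if it is not weakly convergent. A basic sequence is a sequence that is a Schauder basis of its closed linear span. A basic sequence $(x_j)$ is boundedly complete if whenever scalars $(c_j)$ satisfy $\sup_n\|\sum_{j=1}^nc_jx_j\|<\infty$, the series $\sum c_jx_j$ converges. An (s)-sequence is a weak-Cauchy basic sequence $(b_j)$ which dominates the summing basis, i.e. there is a constant $C$ with $\max_{m\le n}|\sum_{j=1}^mc_j|\le C\|\sum_{j=1}^nc_jb_j\|$ for all $n$ and scalars $c_1,\dots,c_n$. *)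

theory Defs
  imports "HOL-Analysis.Analysis"
begin

text \<open>
  Banach spaces are real: the space is the type \<open>'a::banach\<close>, and its dual is the type
  \<open>'a \<Rightarrow>\<^sub>L real\<close> of bounded linear functionals. Sequences are indexed from 0, so the \<open>n\<close>-th
  partial sum of \<open>\<Sum> c\<^sub>j b\<^sub>j\<close> is the sum over \<open>j < n\<close>.
\<close>

definition weak_topology :: "'a::real_normed_vector topology" where
  "weak_topology =
     topology_generated_by {blinfun_apply f -` U | (f :: 'a \<Rightarrow>\<^sub>L real) U. open U}"

text \<open>The property of the whole space \<open>'a\<close>; the weak topology on \<open>F\<close> is induced from \<open>'a\<close>.\<close>

definition PCP :: "'a::real_normed_vector itself \<Rightarrow> bool" where
  "PCP (_ :: 'a itself) \<longleftrightarrow>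
     (\<forall>F :: 'a set. F \<noteq> {} \<and> bounded F \<and> closed F \<longrightarrow>
        (\<exists>p\<in>F. topcontinuous_at (subtopology weak_topology F) (top_of_set F) (\<lambda>y. y) p))"

definition weak_Cauchy :: "(nat \<Rightarrow> 'a::real_normed_vector) \<Rightarrow> bool" where
  "weak_Cauchy x \<longleftrightarrow> (\<forall>f :: 'a \<Rightarrow>\<^sub>L real. convergent (\<lambda>j. f (x j)))"

definition nontrivial_weak_Cauchy :: "(nat \<Rightarrow> 'a::real_normed_vector) \<Rightarrow> bool" where
  "nontrivial_weak_Cauchy x \<longleftrightarrow>
     weak_Cauchy x \<and> \<not> (\<exists>l. limitin weak_topology x l sequentially)"

definition basic_sequence :: "(nat \<Rightarrow> 'a::real_normed_vector) \<Rightarrow> bool" where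
  "basic_sequence b \<longleftrightarrow>
     (\<forall>y \<in> closure (span (range b)). \<exists>!c :: nat \<Rightarrow> real. (\<lambda>j. c j *\<^sub>R b j) sums y)"

definition boundedly_complete :: "(nat \<Rightarrow> 'a::real_normed_vector) \<Rightarrow> bool" where
  "boundedly_complete b \<longleftrightarrow>
     (\<forall>c :: nat \<Rightarrow> real. bdd_above (range (\<lambda>n. norm (\<Sum>j<n. c j *\<^sub>R b j))) \<longrightarrow>
        summable (\<lambda>j. c j *\<^sub>R b j))"

definition dominates_summing_basis :: "(nat \<Rightarrow> 'a::real_normed_vector) \<Rightarrow> bool" where
  "dominates_summing_basis b \<longleftrightarrow>
     (\<exists>C :: real. \<forall>n. \<forall>c :: nat \<Rightarrow> real. \<forall>m\<le>n.
        \<bar>\<Sum>j<m. c j\<bar> \<le> C * norm (\<Sum>j<n. c j *\<^sub>R b j))"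

definition s_sequence :: "(nat \<Rightarrow> 'a::real_normed_vector) \<Rightarrow> bool" where
  "s_sequence b \<longleftrightarrow> weak_Cauchy b \<and> basic_sequence b \<and> dominates_summing_basis b"

end

theory Submission
  imports Defs
begin

text \<open>
  Let \<open>\<phi>\<close> be the weak* limit of \<open>x\<close> in the bidual; it lies at positive distance from the space.
  Choosing each new term close to \<open>\<phi>\<close> on a finite set of functionals that almost norms the span of
  the earlier terms together with \<open>\<phi>\<close> yields a basic subsequence that dominates the summing basis.

  The PCP provides countably many functionals, hence a map into \<open>\<real>\<^sup>\<nat>\<close>, under which the unit ball
  of the closed span is a \<open>G\<^sub>\<delta>\<close> set, i.e. the complement of an increasing union of closed
  sets \<open>F\<^sub>k\<close>. The compact set of combinations of norm at most one of the first \<open>k\<close> terms has a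
  gap from \<open>F\<^sub>k\<close> that is witnessed by finitely many coordinates, on which the later terms are
  chosen close to \<open>\<phi>\<close>. If the partial sums of \<open>\<Sum> c\<^sub>j b\<^sub>j\<close> lie in the unit ball and the
  coefficient sums take one value infinitely often, then along those indices the multiples of
  \<open>\<phi>\<close> cancel, so the limit in \<open>\<real>\<^sup>\<nat>\<close> avoids all \<open>F\<^sub>k\<close> and comes from a vector. Biorthogonal functionals
  identify its expansion as \<open>\<Sum> c\<^sub>j b\<^sub>j\<close>. The general case reduces to this one by an absolutely
  convergent perturbation.
\<close>

section \<open>The Hahn--Banach theorem and weak-Cauchy sequences\<close>

text \<open>Working with graphs turns the extension into a maximal subspace of the product on which
  the second coordinate stays below the norm of the first. The bound at the zero vector, applied to
  both signs, makes such a subspace single-valued.\<close>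

lemma hahn_banach_graph:
  fixes G :: "('a::real_normed_vector \<times> real) set"
  assumes "subspace G" and G: "\<And>x r. (x, r) \<in> G \<Longrightarrow> r \<le> norm x"
  obtains f :: "'a \<Rightarrow>\<^sub>L real" where "\<And>x r. (x, r) \<in> G \<Longrightarrow> f x = r" "norm f \<le> 1"
proof -
  define \<A> where "\<A> = {M. subspace M \<and> G \<subseteq> M \<and> (\<forall>x r. (x, r) \<in> M \<longrightarrow> r \<le> norm x)}"
  have "\<exists>U\<in>\<A>. \<forall>X\<in>\<C>. X \<subseteq> U" if chain: "subset.chain \<A> \<C>" for \<C>
  proof (cases "\<C> = {}")
    case True
    have "G \<in> \<A>" using assms by (auto simp: \<A>_def)
    with True show ?thesis by auto
  next
    case False
    have sub: "\<C> \<subseteq> \<A>" and lin: "\<And>X Y. X \<in> \<C> \<Longrightarrow> Y \<in> \<C> \<Longrightarrow> X \<subseteq> Y \<or> Y \<subseteq> X"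
      using chain by (auto simp: subset.chain_def)
    have "subspace (\<Union>\<C>)"
      unfolding subspace_def
    proof (intro conjI ballI allI)
      obtain X where "X \<in> \<C>" using False by auto
      moreover from this have "subspace X" using sub by (auto simp: \<A>_def)
      ultimately show "0 \<in> \<Union>\<C>" by (auto intro: subspace_0)
    next
      fix a b assume "a \<in> \<Union>\<C>" "b \<in> \<Union>\<C>"
      then obtain X Y where XY: "X \<in> \<C>" "Y \<in> \<C>" "a \<in> X" "b \<in> Y" by auto
      then obtain Z where "Z \<in> \<C>" "a \<in> Z" "b \<in> Z" using lin[of X Y] by blast
      moreover from this have "subspace Z" using sub by (auto simp: \<A>_def)
      ultimately show "a + b \<in> \<Union>\<C>" by (auto intro: subspace_add)
    next
      fix c :: real and a assume "a \<in> \<Union>\<C>"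
      then obtain X where "X \<in> \<C>" "a \<in> X" by auto
      moreover from this have "subspace X" using sub by (auto simp: \<A>_def)
      ultimately show "c *\<^sub>R a \<in> \<Union>\<C>" by (auto intro: subspace_scale)
    qed
    then have "\<Union>\<C> \<in> \<A>" using sub False by (auto simp: \<A>_def)
    then show ?thesis by auto
  qed
  then have "\<exists>M\<in>\<A>. \<forall>X\<in>\<A>. M \<subseteq> X \<longrightarrow> X = M" by (rule subset_Zorn)
  then obtain M where M: "M \<in> \<A>" and max: "\<And>X. X \<in> \<A> \<Longrightarrow> M \<subseteq> X \<Longrightarrow> X = M"
    by metis
  have subM: "subspace M" and GM: "G \<subseteq> M" and le: "\<And>x r. (x, r) \<in> M \<Longrightarrow> r \<le> norm x"
    using M by (auto simp: \<A>_def)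
  \<comment> \<open>Maximality makes the domain the whole space: adjoining \<open>(v, c)\<close> for
    an admissible value \<open>c\<close> gives another member of \<open>\<A>\<close>, hence
    \<open>M\<close> itself.\<close>
  have ex: "\<exists>r. (v, r) \<in> M" for v
  proof -
    \<comment> \<open>The values admissible at \<open>v\<close> lie between the numbers
      \<open>r - norm (x - v)\<close> and the numbers \<open>norm (y + v) - s\<close>; the supremum
      of the lower ones is admissible.\<close>
    define c where "c = (SUP (x, r)\<in>M. r - norm (x - v))"
    have key: "r - norm (x - v) \<le> norm (y + v) - s" if "(x, r) \<in> M" "(y, s) \<in> M" for x r y s
    proof -
      have "(x + y, r + s) \<in> M" using subspace_add[OF subM that] by simp
      then have "r + s \<le> norm (x + y)" by (rule le)
      also have "\<dots> \<le> norm (x - v) + norm (y + v)"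
        using norm_triangle_ineq[of "x - v" "y + v"] by simp
      finally show ?thesis by simp
    qed
    have M0: "(0, 0) \<in> M" using subspace_0[OF subM] by (simp add: zero_prod_def)
    have lo: "r - norm (x - v) \<le> c" if "(x, r) \<in> M" for x r
    proof -
      have "bdd_above ((\<lambda>(x, r). r - norm (x - v)) ` M)"
        using key[OF _ M0] by (intro bdd_aboveI[of _ "norm (0 + v) - 0"]) auto
      then show ?thesis unfolding c_def using cSUP_upper[OF that] by fastforce
    qed
    have hi: "c \<le> norm (y + v) - s" if "(y, s) \<in> M" for y s
      unfolding c_def using M0 key[OF _ that] by (intro cSUP_least) auto
    \<comment> \<open>Dividing by \<open>t\<close> or by \<open>- t\<close> reduces the bound to
      \<open>hi\<close> or \<open>lo\<close>, according to the sign of \<open>t\<close>.\<close>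
    have bnd: "r + t * c \<le> norm (x + t *\<^sub>R v)" if "(x, r) \<in> M" for x r t
    proof -
      consider "t = 0" | "t > 0" | "t < 0" by linarith
      then show ?thesis
      proof cases
        case 1 then show ?thesis using le that by simp
      next
        case 2
        have "((1/t) *\<^sub>R x, r / t) \<in> M" using subspace_scale[OF subM that, of "1/t"] by simp
        from hi[OF this] have "t * c \<le> t * norm ((1/t) *\<^sub>R x + v) - r"
          using 2 by (simp add: field_simps)
        also have "t * norm ((1/t) *\<^sub>R x + v) = norm (t *\<^sub>R ((1/t) *\<^sub>R x + v))" using 2 by simp
        also have "t *\<^sub>R ((1/t) *\<^sub>R x + v) = x + t *\<^sub>R v" using 2 by (simp add: scaleR_right_distrib)
        finally show ?thesis by simp
      next
        case 3
        have "((1/(-t)) *\<^sub>R x, r / (-t)) \<in> M"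
          using subspace_scale[OF subM that, of "1/(-t)"] by simp
        from lo[OF this] have "r - (-t) * norm ((1/(-t)) *\<^sub>R x - v) \<le> (-t) * c"
          using 3 by (simp add: field_simps)
        moreover have "(-t) * norm ((1/(-t)) *\<^sub>R x - v) = norm ((-t) *\<^sub>R ((1/(-t)) *\<^sub>R x - v))"
          using 3 by simp
        moreover have "(-t) *\<^sub>R ((1/(-t)) *\<^sub>R x - v) = x + t *\<^sub>R v"
          using 3 by (simp add: scaleR_right_diff_distrib)
        ultimately have "r - norm (x + t *\<^sub>R v) \<le> (-t) * c" by metis
        then show ?thesis by simp
      qed
    qed
    let ?N = "span (insert (v, c) M)"
    have "?N \<in> \<A>"
      unfolding \<A>_def
    proof (intro CollectI conjI allI impI)
      show "G \<subseteq> ?N" using GM by (meson insert_iff span_superset subset_iff)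
      fix x r assume "(x, r) \<in> ?N"
      then obtain k where "(x, r) - k *\<^sub>R (v, c) \<in> span M" by (auto simp: span_breakdown_eq)
      then have "(x - k *\<^sub>R v, r - k * c) \<in> M" using subM by (simp add: span_eq_iff[THEN iffD2])
      from bnd[OF this, of k] show "r \<le> norm x" by simp
    qed auto
    moreover have "M \<subseteq> ?N" by (meson insert_iff span_superset subset_iff)
    ultimately have "?N = M" by (rule max)
    then have "(v, c) \<in> M" by (metis insertI1 span_base)
    then show ?thesis ..
  qed
  have uniq: "r = s" if "(x, r) \<in> M" "(x, s) \<in> M" for x r s
    using le[of 0 "r - s"] le[of 0 "s - r"] subspace_diff[OF subM that] 
      subspace_diff[OF subM that(2) that(1)] by simp
  define g where "g x = (SOME r. (x, r) \<in> M)" for x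
  have g: "(x, g x) \<in> M" for x unfolding g_def using ex by (rule someI_ex)
  have "bounded_linear g"
  proof (rule bounded_linear_intro[where K = 1])
    show "g (x + y) = g x + g y" for x y
      using uniq[OF g] subspace_add[OF subM g[of x] g[of y]] by simp
    show "g (r *\<^sub>R x) = r *\<^sub>R g x" for r x
      using uniq[OF g] subspace_scale[OF subM g[of x]] by simp
    show "norm (g x) \<le> norm x * 1" for x
      using le[OF g[of x]] le[of "- x" "- g x"] subspace_neg[OF subM g[of x]] by simp
  qed
  then have app: "blinfun_apply (Blinfun g) = g" by (rule bounded_linear_Blinfun_apply)
  show ?thesis
  proof
    show "Blinfun g x = r" if "(x, r) \<in> G" for x r using that GM uniq[OF g] app by auto
    show "norm (Blinfun g) \<le> 1"
    proof (rule norm_blinfun_bound)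
      show "norm (Blinfun g x) \<le> 1 * norm x" for x
        using le[OF g[of x]] le[of "- x" "- g x"] subspace_neg[OF subM g[of x]] app by simp
    qed simp
  qed
qed

text \<open>On the span of \<open>S\<close> and \<open>v\<close> the functional sending
  \<open>w + t *\<^sub>R v\<close> to \<open>t * d\<close> is dominated by the norm, because the
  distance of \<open>t *\<^sub>R v\<close> from \<open>S\<close> is at least \<bar>t\<bar> times
  \<open>d\<close>. Its graph is then extended.\<close>

lemma hahn_banach_separation:
  fixes v :: "'a::real_normed_vector"
  assumes S: "subspace S" and "d \<ge> 0" and d: "\<And>w. w \<in> S \<Longrightarrow> d \<le> norm (v - w)"
  obtains f :: "'a \<Rightarrow>\<^sub>L real" where "\<And>w. w \<in> S \<Longrightarrow> f w = 0" "f v = d" "norm f \<le> 1"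
proof -
  define G where "G = {(w + t *\<^sub>R v, t * d) | w t. w \<in> S}"
  have "subspace G"
    unfolding subspace_def
  proof (intro conjI ballI allI)
    show "0 \<in> G" unfolding G_def zero_prod_def using subspace_0[OF S]
      by (auto intro!: exI[of _ 0] exI[of _ "0::real"])
  next
    fix a b assume "a \<in> G" "b \<in> G"
    then obtain w t w' t' where "a = (w + t *\<^sub>R v, t * d)" "b = (w' + t' *\<^sub>R v, t' * d)"
      "w \<in> S" "w' \<in> S" by (auto simp: G_def)
    then have "a + b = ((w + w') + (t + t') *\<^sub>R v, (t + t') * d)" "w + w' \<in> S"
      using subspace_add[OF S] by (auto simp: algebra_simps)
    then show "a + b \<in> G" unfolding G_def by blast
  next
    fix c :: real and a assume "a \<in> G"
    then obtain w t where "a = (w + t *\<^sub>R v, t * d)" "w \<in> S" by (auto simp: G_def)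
    then have "c *\<^sub>R a = (c *\<^sub>R w + (c * t) *\<^sub>R v, (c * t) * d)" "c *\<^sub>R w \<in> S"
      using subspace_scale[OF S] by (auto simp: algebra_simps)
    then show "c *\<^sub>R a \<in> G" unfolding G_def by blast
  qed
  moreover have "r \<le> norm x" if "(x, r) \<in> G" for x r
  proof -
    from that obtain w t where x: "x = w + t *\<^sub>R v" and r: "r = t * d" and w: "w \<in> S"
      by (auto simp: G_def)
    show ?thesis
    proof (cases "t = 0")
      case False
      have "- ((1/t) *\<^sub>R w) \<in> S" using w subspace_scale[OF S] subspace_neg[OF S] by blast
      then have "d \<le> norm (v + (1/t) *\<^sub>R w)" using d by fastforce
      then have "\<bar>t\<bar> * d \<le> \<bar>t\<bar> * norm (v + (1/t) *\<^sub>R w)" by (simp add: mult_left_mono)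
      also have "\<dots> = norm (t *\<^sub>R (v + (1/t) *\<^sub>R w))" by simp
      also have "t *\<^sub>R (v + (1/t) *\<^sub>R w) = x" using False x by (simp add: scaleR_right_distrib)
      finally show ?thesis using r \<open>d \<ge> 0\<close> by (smt (verit) mult_right_mono)
    qed (use x r in simp)
  qed
  ultimately obtain f :: "'a \<Rightarrow>\<^sub>L real" where f: "\<And>x r. (x, r) \<in> G \<Longrightarrow> f x = r" "norm f \<le> 1"
    using hahn_banach_graph by blast
  show ?thesis
  proof
    show "f w = 0" if "w \<in> S" for w
      using that by (intro f(1)) (auto simp: G_def intro!: exI[of _ w] exI[of _ "0::real"])
    show "f v = d"
      using subspace_0[OF S] by (intro f(1)) (auto simp: G_def intro!: exI[of _ 0] exI[of _ "1::real"])
  qed (rule f(2))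
qed

lemma norming_functional:
  fixes v :: "'a::real_normed_vector"
  obtains f :: "'a \<Rightarrow>\<^sub>L real" where "f v = norm v" "norm f \<le> 1"
  using hahn_banach_separation[of "{0}" "norm v" v] by (auto simp: subspace_def)

lemma abs_blinfun_le:
  fixes f :: "'a::real_normed_vector \<Rightarrow>\<^sub>L real"
  assumes "norm f \<le> 1"
  shows "\<bar>f v\<bar> \<le> norm v"
  using norm_blinfun[of f v] mult_right_mono[OF assms, of "norm v"] by simp

section \<open>Boundedness of weak-Cauchy sequences and their limits in the bidual\<close>

text \<open>This is the uniform boundedness principle for the points \<open>x j\<close> acting on
  the dual: convergent scalar sequences are bounded, so the closed sets \<open>A n\<close> cover the
  dual, and by Baire one of them contains a ball.\<close>

lemma weak_Cauchy_imp_bounded: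
  fixes x :: "nat \<Rightarrow> 'a::banach"
  assumes "weak_Cauchy x"
  obtains L where "L > 0" "\<And>j. norm (x j) \<le> L"
proof -
  define A where "A n = {f :: 'a \<Rightarrow>\<^sub>L real. \<forall>j. \<bar>f (x j)\<bar> \<le> real n}" for n
  have clA: "closed (A n)" for n
  proof -
    have "A n = (\<Inter>j. {f :: 'a \<Rightarrow>\<^sub>L real. \<bar>f (x j)\<bar> \<le> real n})" by (auto simp: A_def)
    then show ?thesis by (simp add: closed_INT closed_Collect_le continuous_intros)
  qed
  have cov: "(\<Union>n. A n) = UNIV"
  proof -
    have "\<exists>n. f \<in> A n" for f :: "'a \<Rightarrow>\<^sub>L real"
    proof -
      have "Bseq (\<lambda>j. f (x j))"
        using assms by (auto simp: weak_Cauchy_def intro: convergent_imp_Bseq)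
      then obtain K where "\<forall>j. \<bar>f (x j)\<bar> \<le> K" by (auto simp: Bseq_def)
      moreover obtain n where "K \<le> real n" using real_arch_simple by blast
      ultimately show ?thesis by (auto simp: A_def intro: order_trans)
    qed
    then show ?thesis by auto
  qed
  have "\<exists>n. interior (A n) \<noteq> {}"
  proof (rule ccontr)
    assume "\<not> ?thesis"
    then have "euclidean interior_of \<Union>(range A) = {}"
      using clA completely_metrizable_space_euclidean
      by (intro Baire_category_alt) auto
    then show False using cov by simp
  qed
  then obtain n f e where e: "e > 0" "cball f e \<subseteq> A n"
    by (auto simp: mem_interior_cball)
  define L where "L = 2 * real n / e + 1"
  show ?thesis
  proof
    show "L > 0" using e by (simp add: L_def add_nonneg_pos)
    fix j
    obtain g :: "'a \<Rightarrow>\<^sub>L real" where g: "g (x j) = norm (x j)" "norm g \<le> 1"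
      by (rule norming_functional)
    \<comment> \<open>Moving from the centre \<open>f\<close> by \<open>e\<close> in the direction
      of a functional that norms \<open>x j\<close> stays in the ball, which turns the bound on the
      ball into one on \<open>norm (x j)\<close>.\<close>
    have "f + e *\<^sub>R g \<in> A n" "f \<in> A n" using e g by (auto simp: dist_norm)
    then have "\<bar>f (x j) + e * norm (x j)\<bar> \<le> n" "\<bar>f (x j)\<bar> \<le> n"
      by (auto simp: A_def blinfun.add_left blinfun.scaleR_left simp flip: g(1))
    then have "e * norm (x j) \<le> 2 * n" by linarith
    then show "norm (x j) \<le> L" using e by (simp add: L_def field_simps)
  qed
qed

lemma limitin_weak_topologyI:
  fixes x :: "nat \<Rightarrow> 'a::real_normed_vector"
  assumes "\<And>f :: 'a \<Rightarrow>\<^sub>L real. (\<lambda>j. f (x j)) \<longlonglongrightarrow> f l"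
  shows "limitin weak_topology x l sequentially"
proof -
  let ?G = "{blinfun_apply f -` U | (f :: 'a \<Rightarrow>\<^sub>L real) U. open U}"
  have "\<forall>\<^sub>F j in sequentially. x j \<in> U" if "generate_topology_on ?G U" "l \<in> U" for U
    using that
  proof (induction rule: generate_topology_on.induct)
    case (Int a b)
    then show ?case by (auto intro: eventually_conj)
  next
    case (UN K)
    then obtain k where "k \<in> K" "l \<in> k" by auto
    with UN.IH[of k] show ?case by (auto elim: eventually_mono)
  next
    case (Basis s)
    then obtain f :: "'a \<Rightarrow>\<^sub>L real" and U where "s = blinfun_apply f -` U" "open U" by auto
    then show ?case using Basis.prems topological_tendstoD[OF assms] by auto
  qed auto
  moreover have "l \<in> topspace weak_topology"
    unfolding weak_topology_def topology_generated_by_topspace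
    by (auto intro!: exI[of _ UNIV] exI[of _ "UNIV :: real set"])
  ultimately show ?thesis
    unfolding limitin_def weak_topology_def openin_topology_generated_by_iff by blast
qed

text \<open>If points approximated \<phi> arbitrarily well, uniformly on the dual unit ball, they
  would form a Cauchy sequence whose limit represents \<phi>, and \<open>x\<close> would converge
  weakly to that limit.\<close>

lemma nontrivial_weak_Cauchy_far_from_points:
  fixes x :: "nat \<Rightarrow> 'a::banach" and \<phi> :: "('a \<Rightarrow>\<^sub>L real) \<Rightarrow> real"
  assumes nt: "nontrivial_weak_Cauchy x"
    and \<phi>: "\<And>f :: 'a \<Rightarrow>\<^sub>L real. (\<lambda>j. blinfun_apply f (x j)) \<longlonglongrightarrow> \<phi> f"
  obtains d where "d > 0" "\<And>s. \<exists>f :: 'a \<Rightarrow>\<^sub>L real. norm f \<le> 1 \<and> d \<le> \<bar>blinfun_apply f s - \<phi> f\<bar>"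
proof (rule ccontr)
  assume contr: "\<not> thesis"
  note obt = that
  have no: "\<exists>s. \<not> (\<exists>f :: 'a \<Rightarrow>\<^sub>L real. norm f \<le> 1 \<and> d \<le> \<bar>blinfun_apply f s - \<phi> f\<bar>)" if "d > 0" for d
    using contr obt[OF that] by blast
  have "\<exists>s. \<forall>f :: 'a \<Rightarrow>\<^sub>L real. norm f \<le> 1 \<longrightarrow> \<bar>blinfun_apply f s - \<phi> f\<bar> < d" if "d > 0" for d
    using no[OF that] by (meson not_le)
  then have "\<exists>s. \<forall>f :: 'a \<Rightarrow>\<^sub>L real. norm f \<le> 1 \<longrightarrow> \<bar>blinfun_apply f s - \<phi> f\<bar> < inverse (real (Suc n))" for n
    by (metis inverse_positive_iff_positive of_nat_0_less_iff zero_less_Suc)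
  then obtain u where u: "\<And>n (f :: 'a \<Rightarrow>\<^sub>L real). norm f \<le> 1 \<Longrightarrow> \<bar>blinfun_apply f (u n) - \<phi> f\<bar> < inverse (real (Suc n))"
    by metis
  have "Cauchy u"
  proof (rule metric_CauchyI)
    fix e :: real assume "e > 0"
    then obtain N where N: "inverse (real (Suc N)) < e / 2"
      using reals_Archimedean[of "e/2"] by auto
    show "\<exists>M. \<forall>m\<ge>M. \<forall>n\<ge>M. dist (u m) (u n) < e"
    proof (intro exI allI impI)
      fix m n assume mn: "m \<ge> N" "n \<ge> N"
      have le: "inverse (real (Suc k)) \<le> inverse (real (Suc N))" if "k \<ge> N" for k
        using that by (simp add: le_imp_inverse_le)
      obtain f :: "'a \<Rightarrow>\<^sub>L real" where f: "f (u m - u n) = norm (u m - u n)" "norm f \<le> 1"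
        by (rule norming_functional)
      show "dist (u m) (u n) < e"
        unfolding dist_norm f(1)[symmetric] blinfun.diff_right
        using u[OF f(2), of m] u[OF f(2), of n] N le[OF mn(1)] le[OF mn(2)] by linarith
    qed
  qed
  then obtain l where l: "u \<longlonglongrightarrow> l" using Cauchy_convergent_iff convergent_def by blast
  have fl: "\<phi> f = f l" if "norm f \<le> 1" for f
  proof -
    have "(\<lambda>n. f (u n) - \<phi> f) \<longlonglongrightarrow> 0"
      using u[OF that] by (intro Lim_null_comparison[OF _ LIMSEQ_inverse_real_of_nat])
        (auto intro!: always_eventually less_imp_le)
    moreover have "(\<lambda>n. f (u n) - \<phi> f) \<longlonglongrightarrow> f l - \<phi> f" using l by (intro tendsto_intros)
    ultimately show ?thesis using LIMSEQ_unique by fastforce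
  qed
  have "(\<lambda>j. f (x j)) \<longlonglongrightarrow> f l" for f :: "'a \<Rightarrow>\<^sub>L real"
  proof -
    \<comment> \<open>The identity \<open>fl\<close> is available only on the unit ball; dividing by
      \<open>norm f + 1\<close> also covers the zero functional.\<close>
    define g where "g = (1 / (norm f + 1)) *\<^sub>R f"
    have pos: "norm f + 1 > 0" by (simp add: add_nonneg_pos)
    have "norm g \<le> 1" using pos by (simp add: g_def)
    then have "(\<lambda>j. g (x j)) \<longlonglongrightarrow> g l" using \<phi>[of g] fl by simp
    then have "(\<lambda>j. (norm f + 1) * g (x j)) \<longlonglongrightarrow> (norm f + 1) * g l" by (rule tendsto_mult_left)
    then show ?thesis using pos by (simp add: g_def blinfun.scaleR_left)
  qed
  then have "limitin weak_topology x l sequentially" by (rule limitin_weak_topologyI)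
  then show False using nt by (auto simp: nontrivial_weak_Cauchy_def)
qed

text \<open>With \<open>\<phi>\<close> the weak* limit of \<open>x\<close> in the bidual, this says that \<open>'a\<close> and \<open>\<real>\<phi>\<close> form a
  topological direct sum.\<close>

lemma nontrivial_weak_Cauchy_direct_sum:
  fixes x :: "nat \<Rightarrow> 'a::banach" and \<phi> :: "('a \<Rightarrow>\<^sub>L real) \<Rightarrow> real"
  assumes nt: "nontrivial_weak_Cauchy x"
    and \<phi>: "\<And>f :: 'a \<Rightarrow>\<^sub>L real. (\<lambda>j. blinfun_apply f (x j)) \<longlonglongrightarrow> \<phi> f"
  obtains \<kappa> where "\<kappa> > 0"
    "\<And>s \<tau>. \<exists>f :: 'a \<Rightarrow>\<^sub>L real. norm f \<le> 1 \<and> \<kappa> * (norm s + \<bar>\<tau>\<bar>) \<le> \<bar>blinfun_apply f s + \<tau> * \<phi> f\<bar>"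
proof -
  obtain d where d: "d > 0" "\<And>s. \<exists>f :: 'a \<Rightarrow>\<^sub>L real. norm f \<le> 1 \<and> d \<le> \<bar>blinfun_apply f s - \<phi> f\<bar>"
    using nontrivial_weak_Cauchy_far_from_points[OF nt \<phi>] by blast
  obtain L where L: "L > 0" "\<And>j. norm (x j) \<le> L"
    using nt weak_Cauchy_imp_bounded unfolding nontrivial_weak_Cauchy_def by blast
  have \<phi>L: "\<bar>\<phi> f\<bar> \<le> L" if "norm f \<le> 1" for f
  proof (rule LIMSEQ_le_const2)
    show "(\<lambda>j. \<bar>f (x j)\<bar>) \<longlonglongrightarrow> \<bar>\<phi> f\<bar>" using \<phi> by (rule tendsto_rabs)
    show "\<exists>N. \<forall>j\<ge>N. \<bar>f (x j)\<bar> \<le> L" using abs_blinfun_le[OF that] L(2) order_trans by blast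
  qed
  \<comment> \<open>The constant serves two regimes. If \<open>norm s\<close> is at least
    \<open>2 * L * \<bar>\<tau>\<bar>\<close>, a functional norming \<open>s\<close> wins because
    \<phi> is bounded by \<open>L\<close> on the unit ball. Otherwise \<tau> is nonzero, and
    division by it reduces to the distance \<open>d\<close> between \<phi> and the points.\<close>
  define \<kappa> where "\<kappa> = min L d / (2 * L + 1)"
  show ?thesis
  proof
    show "\<kappa> > 0" using L d by (simp add: \<kappa>_def)
    fix s :: 'a and \<tau> :: real
    show "\<exists>f :: 'a \<Rightarrow>\<^sub>L real. norm f \<le> 1 \<and> \<kappa> * (norm s + \<bar>\<tau>\<bar>) \<le> \<bar>blinfun_apply f s + \<tau> * \<phi> f\<bar>"
    proof (cases "2 * L * \<bar>\<tau>\<bar> \<le> norm s")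
      case True
      obtain f :: "'a \<Rightarrow>\<^sub>L real" where f: "f s = norm s" "norm f \<le> 1" by (rule norming_functional)
      have "\<kappa> * (norm s + \<bar>\<tau>\<bar>) \<le> L / (2 * L + 1) * (norm s + \<bar>\<tau>\<bar>)"
        using L by (intro mult_right_mono) (auto simp: \<kappa>_def divide_right_mono)
      also have "\<dots> \<le> norm s - L * \<bar>\<tau>\<bar>"
      proof -
        have "L * (norm s + \<bar>\<tau>\<bar>) \<le> (norm s - L * \<bar>\<tau>\<bar>) * (2 * L + 1)"
          using True mult_left_mono[OF True less_imp_le[OF L(1)]] by (simp add: algebra_simps)
        then show ?thesis using L by (simp add: pos_divide_le_eq)
      qed
      also have "\<dots> \<le> \<bar>blinfun_apply f s + \<tau> * \<phi> f\<bar>"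
      proof -
        have "\<bar>\<tau> * \<phi> f\<bar> \<le> L * \<bar>\<tau>\<bar>"
          using mult_right_mono[OF \<phi>L[OF f(2)], of "\<bar>\<tau>\<bar>"] by (simp add: abs_mult mult.commute)
        then show ?thesis using f(1) by linarith
      qed
      finally show ?thesis using f(2) by blast
    next
      case False
      then have "\<tau> \<noteq> 0" by force
      then have \<tau>: "\<bar>\<tau>\<bar> > 0" "\<tau> \<noteq> 0" by simp_all
      obtain f :: "'a \<Rightarrow>\<^sub>L real" where f: "norm f \<le> 1" "d \<le> \<bar>f ((- 1 / \<tau>) *\<^sub>R s) - \<phi> f\<bar>"
        using d(2) by blast
      have "\<kappa> * (norm s + \<bar>\<tau>\<bar>) \<le> \<kappa> * ((2 * L + 1) * \<bar>\<tau>\<bar>)"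
        using False L d by (intro mult_left_mono) (auto simp: \<kappa>_def algebra_simps)
      also have "\<dots> \<le> d * \<bar>\<tau>\<bar>"
        using L \<tau> by (simp add: \<kappa>_def)
      also have "\<dots> \<le> \<bar>f ((- 1 / \<tau>) *\<^sub>R s) - \<phi> f\<bar> * \<bar>\<tau>\<bar>" using f(2) by (intro mult_right_mono) auto
      also have "\<dots> = \<bar>f s + \<tau> * \<phi> f\<bar>"
      proof -
        have "(f ((- 1 / \<tau>) *\<^sub>R s) - \<phi> f) * \<tau> = - (f s + \<tau> * \<phi> f)"
          using \<tau> by (simp add: blinfun.scaleR_right blinfun.minus_right field_simps)
        then show ?thesis by (metis abs_minus_cancel abs_mult)
      qed
      finally show ?thesis using f(1) by blast
    qed
  qed
qed

section \<open>Diagonal selection and finite norming sets\<close>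

text \<open>The list is the initial segment of chosen indices from which a requirement is built; the
  requirement then binds every later choice, with a tolerance that may depend on the stage
  \<open>j\<close>. At each stage only finitely many eventual conditions compete.\<close>

lemma diagonal_selection:
  fixes P :: "nat list \<Rightarrow> nat \<Rightarrow> nat \<Rightarrow> bool"
  assumes "\<And>l j. \<forall>\<^sub>F i in sequentially. P l j i"
  obtains r where "strict_mono r" "\<And>k j. k \<le> j \<Longrightarrow> P (map r [0..<k]) j (r j)"
proof -
  have "\<exists>r. \<forall>j. (\<forall>m<j. r m < r j) \<and> (\<forall>k\<le>j. P (map r [0..<k]) j (r j))"
  proof (rule dependent_wellorder_choice)
    fix i j :: nat and f g :: "nat \<Rightarrow> nat"
    assume "\<And>y. y < j \<Longrightarrow> f y = g y"
    then have eq: "map f [0..<k] = map g [0..<k]" if "k \<le> j" for k using that by auto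
    then have eq': "P (map f [0..<k]) j i = P (map g [0..<k]) j i" if "k \<le> j" for k
      using that by (simp only: eq)
    show "((\<forall>m<j. f m < i) \<and> (\<forall>k\<le>j. P (map f [0..<k]) j i)) =
        ((\<forall>m<j. g m < i) \<and> (\<forall>k\<le>j. P (map g [0..<k]) j i))"
      by (intro conj_cong all_cong) (simp_all add: eq' \<open>\<And>y. y < j \<Longrightarrow> f y = g y\<close>)
  next
    fix j :: nat and f :: "nat \<Rightarrow> nat"
    have "\<forall>\<^sub>F i in sequentially. \<forall>m\<in>{..<j}. f m < i"
      by (intro eventually_ball_finite) (auto simp: eventually_gt_at_top)
    moreover have "\<forall>\<^sub>F i in sequentially. \<forall>k\<in>{..j}. P (map f [0..<k]) j i"
      using assms by (intro eventually_ball_finite) auto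
    ultimately have "\<forall>\<^sub>F i in sequentially. (\<forall>m\<in>{..<j}. f m < i) \<and> (\<forall>k\<in>{..j}. P (map f [0..<k]) j i)"
      by (rule eventually_conj)
    from eventually_happens'[OF sequentially_bot this]
    show "\<exists>i. (\<forall>m<j. f m < i) \<and> (\<forall>k\<le>j. P (map f [0..<k]) j i)"
      unfolding Ball_def lessThan_iff atMost_iff .
  qed
  then obtain r where "\<forall>j. (\<forall>m<j. r m < r j) \<and> (\<forall>k\<le>j. P (map r [0..<k]) j (r j))" ..
  then show ?thesis by (intro that[of r]) (auto simp: strict_mono_def)
qed

lemma compact_bounded_combinations:
  fixes v :: "nat \<Rightarrow> 'a::real_normed_vector"
  shows "compact {\<Sum>j<n. c j *\<^sub>R v j | c. \<forall>j<n. \<bar>c j\<bar> \<le> M}"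
proof (induction n)
  case (Suc n)
  let ?K = "{\<Sum>j<n. c j *\<^sub>R v j | c. \<forall>j<n. \<bar>c j\<bar> \<le> M}"
  have "compact ((\<lambda>t. t *\<^sub>R v n) ` {- M..M})"
    by (intro compact_continuous_image continuous_intros) auto
  from compact_sums[OF Suc this]
  have "compact {s + y |s y. s \<in> ?K \<and> y \<in> (\<lambda>t. t *\<^sub>R v n) ` {- M..M}}" .
  also have "{s + y |s y. s \<in> ?K \<and> y \<in> (\<lambda>t. t *\<^sub>R v n) ` {- M..M}} =
      {\<Sum>j<Suc n. c j *\<^sub>R v j | c. \<forall>j<Suc n. \<bar>c j\<bar> \<le> M}" (is "?A = ?B")
  proof (intro equalityI subsetI)
    fix z assume "z \<in> ?A"
    then obtain c t where z: "z = (\<Sum>j<n. c j *\<^sub>R v j) + t *\<^sub>R v n" "\<forall>j<n. \<bar>c j\<bar> \<le> M" "\<bar>t\<bar> \<le> M"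
      by auto
    have "(\<Sum>j<n. (c(n := t)) j *\<^sub>R v j) = (\<Sum>j<n. c j *\<^sub>R v j)" by (intro sum.cong) auto
    with z show "z \<in> ?B" by (intro CollectI exI[of _ "c(n := t)"]) (auto simp: less_Suc_eq)
  next
    fix z assume "z \<in> ?B"
    then obtain c where "z = (\<Sum>j<Suc n. c j *\<^sub>R v j)" "\<forall>j<Suc n. \<bar>c j\<bar> \<le> M" by auto
    then have "z = (\<Sum>j<n. c j *\<^sub>R v j) + c n *\<^sub>R v n" "\<forall>j<n. \<bar>c j\<bar> \<le> M" "c n \<in> {- M..M}"
      by (auto simp: abs_le_iff minus_le_iff)
    then show "z \<in> ?A" by blast
  qed
  finally show ?case .
qed auto

text \<open>With the slack \<epsilon> the norming inequality becomes strict, hence open in the pair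
  of \<open>s\<close> and \<tau>, and compactness of \<open>K \<times> {- 1..1}\<close> leaves
  finitely many functionals.\<close>

lemma finite_norming_set:
  fixes \<phi> :: "('a::real_normed_vector \<Rightarrow>\<^sub>L real) \<Rightarrow> real"
  assumes \<kappa>: "\<And>s \<tau>. \<exists>f :: 'a \<Rightarrow>\<^sub>L real. norm f \<le> 1 \<and> \<kappa> * (norm s + \<bar>\<tau>\<bar>) \<le> \<bar>blinfun_apply f s + \<tau> * \<phi> f\<bar>"
    and "compact K" "\<epsilon> > 0"
  obtains \<Phi> where "finite \<Phi>" "\<And>f. f \<in> \<Phi> \<Longrightarrow> norm f \<le> 1"
    "\<And>s \<tau>. s \<in> K \<Longrightarrow> \<bar>\<tau>\<bar> \<le> 1 \<Longrightarrow> \<exists>f\<in>\<Phi>. \<kappa> * (norm s + \<bar>\<tau>\<bar>) - \<epsilon> \<le> \<bar>blinfun_apply f s + \<tau> * \<phi> f\<bar>"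
proof -
  define U where "U f = {p. \<kappa> * (norm (fst p) + \<bar>snd p\<bar>) - \<epsilon> < \<bar>f (fst p) + snd p * \<phi> f\<bar>}"
    for f :: "'a \<Rightarrow>\<^sub>L real"
  have "compact (K \<times> {- 1..1::real})" using \<open>compact K\<close> by (intro compact_Times) auto
  moreover have "open (U f)" for f
    unfolding U_def by (intro open_Collect_less continuous_intros)
  moreover have "K \<times> {- 1..1::real} \<subseteq> (\<Union>f\<in>{f. norm f \<le> 1}. U f)"
  proof
    fix p :: "'a \<times> real"
    obtain f :: "'a \<Rightarrow>\<^sub>L real" where "norm f \<le> 1"
      "\<kappa> * (norm (fst p) + \<bar>snd p\<bar>) \<le> \<bar>f (fst p) + snd p * \<phi> f\<bar>"
      using \<kappa> by blast
    then show "p \<in> (\<Union>f\<in>{f. norm f \<le> 1}. U f)" using \<open>\<epsilon> > 0\<close> by (auto simp: U_def)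
  qed
  ultimately obtain \<Phi> where \<Phi>: "\<Phi> \<subseteq> {f. norm f \<le> 1}" "finite \<Phi>" "K \<times> {- 1..1::real} \<subseteq> (\<Union>f\<in>\<Phi>. U f)"
    by (rule compactE_image)
  show ?thesis
  proof
    show "finite \<Phi>" by fact
    show "norm f \<le> 1" if "f \<in> \<Phi>" for f using that \<Phi> by auto
    show "\<exists>f\<in>\<Phi>. \<kappa> * (norm s + \<bar>\<tau>\<bar>) - \<epsilon> \<le> \<bar>blinfun_apply f s + \<tau> * \<phi> f\<bar>" if "s \<in> K" "\<bar>\<tau>\<bar> \<le> 1" for s \<tau>
    proof -
      have "(s, \<tau>) \<in> K \<times> {- 1..1}" using that by (auto simp: abs_le_iff)
      then obtain f where "f \<in> \<Phi>" "(s, \<tau>) \<in> U f" using \<Phi>(3) by blast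
      then show ?thesis by (intro bexI[of _ f]) (auto simp: U_def)
    qed
  qed
qed

lemma sum_scaled_half_powers_le:
  fixes \<delta> :: real
  assumes "\<delta> \<ge> 0"
  shows "(\<Sum>j=k..<n. \<delta> * (1/2)^(Suc j)) \<le> \<delta> * (1/2)^k"
proof (cases "k \<le> n")
  case True
  then have "(\<Sum>j=k..<n. \<delta> * (1/2)^(Suc j)) = \<delta> * (1/2)^k - \<delta> * (1/2)^n"
    by (induction rule: dec_induct) (auto simp: algebra_simps)
  then show ?thesis using assms by simp
qed (use assms in simp)

section \<open>Sequences dominating the summing basis\<close>

text \<open>One inequality carries both the basis constant and the domination of the summing basis,
  so both properties pass to subsequences together.\<close>

definition summing_bound :: "real \<Rightarrow> (nat \<Rightarrow> 'a::real_normed_vector) \<Rightarrow> bool" where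
  "summing_bound C b \<longleftrightarrow> (\<forall>c :: nat \<Rightarrow> real. \<forall>n. \<forall>m\<le>n.
     norm (\<Sum>j<m. c j *\<^sub>R b j) + \<bar>\<Sum>j<m. c j\<bar> \<le> C * norm (\<Sum>j<n. c j *\<^sub>R b j))"

lemma summing_boundD:
  assumes "summing_bound C b" "m \<le> n"
  shows "norm (\<Sum>j<m. c j *\<^sub>R b j) \<le> C * norm (\<Sum>j<n. c j *\<^sub>R b j)"
    and "\<bar>\<Sum>j<m. c j\<bar> \<le> C * norm (\<Sum>j<n. c j *\<^sub>R b j)"
proof -
  have "norm (\<Sum>j<m. c j *\<^sub>R b j) + \<bar>\<Sum>j<m. c j\<bar> \<le> C * norm (\<Sum>j<n. c j *\<^sub>R b j)"
    using assms by (auto simp: summing_bound_def)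
  then show "norm (\<Sum>j<m. c j *\<^sub>R b j) \<le> C * norm (\<Sum>j<n. c j *\<^sub>R b j)"
    and "\<bar>\<Sum>j<m. c j\<bar> \<le> C * norm (\<Sum>j<n. c j *\<^sub>R b j)"
    using norm_ge_zero[of "\<Sum>j<m. c j *\<^sub>R b j"] abs_ge_zero[of "\<Sum>j<m. c j"] by linarith+
qed

lemma summing_bound_coeff:
  assumes "summing_bound C b" "j < n"
  shows "\<bar>c j\<bar> \<le> 2 * C * norm (\<Sum>j<n. c j *\<^sub>R b j)"
proof -
  have "\<bar>\<Sum>i<Suc j. c i\<bar> \<le> C * norm (\<Sum>j<n. c j *\<^sub>R b j)"
    and "\<bar>\<Sum>i<j. c i\<bar> \<le> C * norm (\<Sum>j<n. c j *\<^sub>R b j)"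
    using assms by (auto intro!: summing_boundD(2) simp del: sum.lessThan_Suc)
  then show ?thesis by simp
qed

lemma summing_bound_dominates: "summing_bound C b \<Longrightarrow> dominates_summing_basis b"
  unfolding dominates_summing_basis_def using summing_boundD(2) by blast

lemma sum_lessThan_eq_atLeastLessThan:
  fixes g :: "nat \<Rightarrow> 'a::ab_group_add"
  assumes "k \<le> n"
  shows "sum g {..<n} = sum g {..<k} + sum g {k..<n}"
  using sum.atLeastLessThan_concat[of 0 k n g] assms by (simp add: lessThan_atLeast0)

text \<open>Each term from \<open>k\<close> on takes nearly the value \<open>t\<close> under
  \<open>f\<close>, with summable errors, so the tail acts on \<open>f\<close> like its coefficient
  sum times \<open>t\<close>. In the applications \<open>t\<close> is the value of the bidual limit
  at \<open>f\<close>.\<close>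

lemma blinfun_tail_estimate:
  fixes f :: "'a::real_normed_vector \<Rightarrow>\<^sub>L real"
  assumes "k \<le> n" and c: "\<And>j. j < n \<Longrightarrow> \<bar>c j\<bar> \<le> A" and "A \<ge> 0" "\<delta> \<ge> 0"
    and b: "\<And>j. k \<le> j \<Longrightarrow> \<bar>f (b j) - t\<bar> \<le> \<delta> * (1/2)^(Suc j)"
  shows "\<bar>f (\<Sum>j<n. c j *\<^sub>R b j) - f (\<Sum>j<k. c j *\<^sub>R b j) - ((\<Sum>j<n. c j) - (\<Sum>j<k. c j)) * t\<bar>
           \<le> A * (\<delta> * (1/2)^k)"
proof -
  have "f (\<Sum>j<n. c j *\<^sub>R b j) - f (\<Sum>j<k. c j *\<^sub>R b j) - ((\<Sum>j<n. c j) - (\<Sum>j<k. c j)) * t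
      = (\<Sum>j=k..<n. c j * (f (b j) - t))"
    using sum_lessThan_eq_atLeastLessThan[OF \<open>k \<le> n\<close>, of "\<lambda>j. c j *\<^sub>R b j"]
      sum_lessThan_eq_atLeastLessThan[OF \<open>k \<le> n\<close>, of c]
    by (simp add: blinfun.add_right blinfun.sum_right blinfun.scaleR_right right_diff_distrib
        sum_subtractf sum_distrib_right)
  also have "\<bar>\<dots>\<bar> \<le> (\<Sum>j=k..<n. A * (\<delta> * (1/2)^(Suc j)))"
  proof (intro order_trans[OF sum_abs] sum_mono)
    fix j assume "j \<in> {k..<n}"
    then show "\<bar>c j * (f (b j) - t)\<bar> \<le> A * (\<delta> * (1/2)^(Suc j))"
      unfolding abs_mult using \<open>A \<ge> 0\<close> by (intro mult_mono c b) auto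
  qed
  also have "\<dots> = A * (\<Sum>j=k..<n. \<delta> * (1/2)^(Suc j))" by (simp only: sum_distrib_left)
  also have "\<dots> \<le> A * (\<delta> * (1/2)^k)"
    using sum_scaled_half_powers_le[OF \<open>\<delta> \<ge> 0\<close>] \<open>A \<ge> 0\<close> by (intro mult_left_mono) auto
  finally show ?thesis .
qed

text \<open>For the functionals that almost norm the first \<open>k\<close> terms together with
  \<phi>, the later terms behave like \<phi>. Hence the norm of a long partial sum controls both its
  initial part and the coefficient sum of its tail.\<close>

lemma summing_bound_subsequence_exists:
  fixes x :: "nat \<Rightarrow> 'a::banach"
  assumes nt: "nontrivial_weak_Cauchy x"
  obtains r C where "strict_mono r" "C > 0" "summing_bound C (x \<circ> r)"
proof -
  define \<phi> where "\<phi> f = lim (\<lambda>j. blinfun_apply f (x j))" for f :: "'a \<Rightarrow>\<^sub>L real"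
  have \<phi>: "(\<lambda>j. blinfun_apply f (x j)) \<longlonglongrightarrow> \<phi> f" for f
    using nt by (auto simp: \<phi>_def nontrivial_weak_Cauchy_def weak_Cauchy_def convergent_LIMSEQ_iff)
  obtain \<kappa> where \<kappa>: "\<kappa> > 0"
    "\<And>s \<tau>. \<exists>f :: 'a \<Rightarrow>\<^sub>L real. norm f \<le> 1 \<and> \<kappa> * (norm s + \<bar>\<tau>\<bar>) \<le> \<bar>blinfun_apply f s + \<tau> * \<phi> f\<bar>"
    using nontrivial_weak_Cauchy_direct_sum[OF nt \<phi>] by blast
  \<comment> \<open>The slack in norming and the tail error each cost
    \<open>2 * N * \<epsilon>\<close>, so together they cost
    \<open>\<kappa> / 4 * N\<close>.\<close>
  define \<epsilon> where "\<epsilon> = \<kappa> / 16"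
  have "\<epsilon> > 0" using \<kappa> by (simp add: \<epsilon>_def)
  define K where "K l = {\<Sum>j<length l. c j *\<^sub>R x (l ! j) | c. \<forall>j<length l. \<bar>c j\<bar> \<le> 1}" for l
  have "\<exists>\<Phi>. finite \<Phi> \<and> (\<forall>f\<in>\<Phi>. norm f \<le> 1) \<and>
    (\<forall>s \<tau>. s \<in> K l \<longrightarrow> \<bar>\<tau>\<bar> \<le> 1 \<longrightarrow> (\<exists>f\<in>\<Phi>. \<kappa> * (norm s + \<bar>\<tau>\<bar>) - \<epsilon> \<le> \<bar>blinfun_apply f s + \<tau> * \<phi> f\<bar>))" for l
  proof -
    have "compact (K l)" unfolding K_def by (rule compact_bounded_combinations)
    from finite_norming_set[OF \<kappa>(2) this \<open>\<epsilon> > 0\<close>] show ?thesis by metis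
  qed
  then obtain \<Phi> where \<Phi>: "\<And>l. finite (\<Phi> l)" "\<And>l f. f \<in> \<Phi> l \<Longrightarrow> norm f \<le> 1"
    "\<And>l s \<tau>. s \<in> K l \<Longrightarrow> \<bar>\<tau>\<bar> \<le> 1 \<Longrightarrow> \<exists>f\<in>\<Phi> l. \<kappa> * (norm s + \<bar>\<tau>\<bar>) - \<epsilon> \<le> \<bar>blinfun_apply f s + \<tau> * \<phi> f\<bar>"
    by metis
  have ev: "\<forall>\<^sub>F i in sequentially. \<forall>f\<in>\<Phi> l. \<bar>blinfun_apply f (x i) - \<phi> f\<bar> \<le> \<epsilon> * (1/2)^(Suc j)" for l j
  proof (intro eventually_ball_finite \<Phi> ballI)
    fix f
    have "\<epsilon> * (1/2)^(Suc j) > 0" using \<open>\<epsilon> > 0\<close> by simp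
    from tendstoD[OF \<phi> this, of f]
    show "\<forall>\<^sub>F i in sequentially. \<bar>blinfun_apply f (x i) - \<phi> f\<bar> \<le> \<epsilon> * (1/2)^(Suc j)"
      by eventually_elim (simp add: dist_real_def)
  qed
  then obtain r where r: "strict_mono r"
    "\<And>k j. k \<le> j \<Longrightarrow> \<forall>f\<in>\<Phi> (map r [0..<k]). \<bar>blinfun_apply f (x (r j)) - \<phi> f\<bar> \<le> \<epsilon> * (1/2)^(Suc j)"
    using diagonal_selection[of "\<lambda>l j i. \<forall>f\<in>\<Phi> l. \<bar>blinfun_apply f (x i) - \<phi> f\<bar> \<le> \<epsilon> * (1/2)^(Suc j)", OF ev]
    by blast
  define b where "b = x \<circ> r"
  have "norm (\<Sum>j<m. c j *\<^sub>R b j) + \<bar>\<Sum>j<m. c j\<bar> \<le> 4 / \<kappa> * norm (\<Sum>j<n. c j *\<^sub>R b j)"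
    if "m \<le> n" for c :: "nat \<Rightarrow> real" and m n
  proof -
    define s where "s m = (\<Sum>j<m. c j *\<^sub>R b j)" for m
    define \<sigma> where "\<sigma> m = (\<Sum>j<m. c j)" for m
    \<comment> \<open>\<open>N\<close> is the largest of the quantities to be bounded. All
      coefficients are at most \<open>2 * N\<close>, so every error is a small multiple of
      \<open>N\<close> and can be absorbed at the end.\<close>
    define N where "N = Max ((\<lambda>m. norm (s m) + \<bar>\<sigma> m\<bar>) ` {..n})"
    have N: "norm (s m) + \<bar>\<sigma> m\<bar> \<le> N" if "m \<le> n" for m
      unfolding N_def using that by (intro Max_ge) auto
    have "N \<in> (\<lambda>m. norm (s m) + \<bar>\<sigma> m\<bar>) ` {..n}" unfolding N_def by (intro Max_in) auto
    then obtain m0 where m0: "m0 \<le> n" "N = norm (s m0) + \<bar>\<sigma> m0\<bar>" by auto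
    have "N \<ge> 0" using m0 by simp
    have \<sigma>N: "\<bar>\<sigma> m\<bar> \<le> N" if "m \<le> n" for m using N[OF that] norm_ge_zero[of "s m"] by linarith
    have cN: "\<bar>c j\<bar> \<le> 2 * N" if "j < n" for j
      using \<sigma>N[of j] \<sigma>N[of "Suc j"] that by (simp add: \<sigma>_def)
    have key: "\<kappa> * (norm (s k) + \<bar>\<sigma> n - \<sigma> k\<bar>) \<le> norm (s n) + \<kappa> / 4 * N" if "k \<le> n" for k
    proof (cases "N = 0")
      case True
      then have "norm (s k) + \<bar>\<sigma> k\<bar> \<le> 0" "\<bar>\<sigma> n\<bar> \<le> 0" using N[OF that] \<sigma>N[of n] by auto
      then have "norm (s k) = 0" "\<bar>\<sigma> k\<bar> = 0" "\<bar>\<sigma> n\<bar> = 0"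
        using norm_ge_zero[of "s k"] abs_ge_zero[of "\<sigma> k"] abs_ge_zero[of "\<sigma> n"] by linarith+
      then have "s k = 0" "\<sigma> k = 0" "\<sigma> n = 0" by simp_all
      then show ?thesis using True by simp
    next
      case False
      with \<open>N \<ge> 0\<close> have "2 * N > 0" by simp
      \<comment> \<open>Scaling by \<open>2 * N\<close> brings the partial sum into
        \<open>K ?l\<close> and the coefficient sum of the tail into \<open>{- 1..1}\<close>, where
        the finite norming set applies.\<close>
      define \<tau> where "\<tau> = (\<sigma> n - \<sigma> k) / (2 * N)"
      let ?l = "map r [0..<k]"
      have "(1 / (2 * N)) *\<^sub>R s k = (\<Sum>j<length ?l. (c j / (2 * N)) *\<^sub>R x (?l ! j))"
        by (simp add: s_def b_def scaleR_right.sum)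
      moreover have "\<forall>j<length ?l. \<bar>c j / (2 * N)\<bar> \<le> 1"
        using cN that \<open>2 * N > 0\<close> by (auto simp: abs_divide)
      ultimately have "(1 / (2 * N)) *\<^sub>R s k \<in> K ?l"
        unfolding K_def by (intro CollectI exI[of _ "\<lambda>j. c j / (2 * N)"] conjI)
      moreover have "\<bar>\<tau>\<bar> \<le> 1"
        using \<sigma>N[of n] \<sigma>N[OF that] \<open>2 * N > 0\<close> by (simp add: \<tau>_def abs_divide)
      ultimately obtain f where f: "f \<in> \<Phi> ?l"
        "\<kappa> * (norm ((1 / (2 * N)) *\<^sub>R s k) + \<bar>\<tau>\<bar>) - \<epsilon> \<le> \<bar>blinfun_apply f ((1 / (2 * N)) *\<^sub>R s k) + \<tau> * \<phi> f\<bar>"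
        using \<Phi>(3) by blast
      have "\<kappa> * (norm (s k) + \<bar>\<sigma> n - \<sigma> k\<bar>) - \<epsilon> * (2 * N)
          = (\<kappa> * (norm ((1 / (2 * N)) *\<^sub>R s k) + \<bar>\<tau>\<bar>) - \<epsilon>) * (2 * N)"
        using \<open>2 * N > 0\<close> by (simp add: \<tau>_def abs_divide field_simps)
      also have "\<dots> \<le> \<bar>blinfun_apply f ((1 / (2 * N)) *\<^sub>R s k) + \<tau> * \<phi> f\<bar> * (2 * N)"
        using f(2) \<open>2 * N > 0\<close> by (intro mult_right_mono) auto
      also have "\<dots> = \<bar>(blinfun_apply f ((1 / (2 * N)) *\<^sub>R s k) + \<tau> * \<phi> f) * (2 * N)\<bar>"
        using \<open>2 * N > 0\<close> by (simp add: abs_mult)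
      also have "(blinfun_apply f ((1 / (2 * N)) *\<^sub>R s k) + \<tau> * \<phi> f) * (2 * N) = blinfun_apply f (s k) + (\<sigma> n - \<sigma> k) * \<phi> f"
        using \<open>2 * N > 0\<close> by (simp add: \<tau>_def blinfun.scaleR_right field_simps)
      finally have 1: "\<kappa> * (norm (s k) + \<bar>\<sigma> n - \<sigma> k\<bar>) - \<epsilon> * (2 * N) \<le> \<bar>blinfun_apply f (s k) + (\<sigma> n - \<sigma> k) * \<phi> f\<bar>" .
      have "\<bar>blinfun_apply f (s n) - blinfun_apply f (s k) - (\<sigma> n - \<sigma> k) * \<phi> f\<bar> \<le> 2 * N * (\<epsilon> * (1/2)^k)"
        unfolding s_def \<sigma>_def using that cN r(2) f(1) \<open>\<epsilon> > 0\<close> \<open>N \<ge> 0\<close>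
        by (intro blinfun_tail_estimate) (auto simp: b_def)
      also have "\<dots> \<le> 2 * N * (\<epsilon> * 1)"
        using \<open>2 * N > 0\<close> \<open>\<epsilon> > 0\<close> by (intro mult_left_mono) (auto simp: power_le_one)
      finally have 2: "\<bar>blinfun_apply f (s n) - blinfun_apply f (s k) - (\<sigma> n - \<sigma> k) * \<phi> f\<bar> \<le> 2 * N * \<epsilon>" by simp
      have "\<bar>blinfun_apply f (s n)\<bar> \<le> norm (s n)" using \<Phi>(2)[OF f(1)] by (rule abs_blinfun_le)
      moreover have e: "\<epsilon> * (2 * N) = \<kappa> * N / 8" by (simp add: \<epsilon>_def)
      moreover have "2 * N * \<epsilon> = \<kappa> * N / 8" by (simp add: \<epsilon>_def)
      moreover have "\<kappa> / 4 * N = \<kappa> * N / 4" by simp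
      ultimately show ?thesis using 1 2 by argo
    qed
    have s0: "s 0 = 0" "\<sigma> 0 = 0" by (simp_all add: s_def \<sigma>_def)
    \<comment> \<open>\<open>key\<close> at \<open>m0\<close> bounds the maximum up to the term with
      \<open>\<sigma> n\<close>, and \<open>key\<close> at 0 bounds that term. The errors add up to
      half of \<open>\<kappa> * N\<close>, which is absorbed on the left.\<close>
    have "\<kappa> * (norm (s m0) + \<bar>\<sigma> m0\<bar>) \<le> \<kappa> * (norm (s m0) + \<bar>\<sigma> n - \<sigma> m0\<bar>) + \<kappa> * \<bar>\<sigma> n\<bar>"
      using \<kappa>(1) by (simp flip: distrib_left)
    also have "\<dots> \<le> 2 * norm (s n) + \<kappa> / 2 * N"
      using key[OF m0(1)] key[of 0] by (simp add: s0)
    finally have "\<kappa> * N \<le> 4 * norm (s n)" using m0(2) by simp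
    then have "N \<le> 4 / \<kappa> * norm (s n)" using \<kappa>(1) by (simp add: field_simps)
    then show ?thesis using N[OF that] by (simp add: s_def \<sigma>_def)
  qed
  then have "summing_bound (4 / \<kappa>) (x \<circ> r)" by (simp add: summing_bound_def b_def)
  then show ?thesis using r(1) \<kappa>(1) that by (meson divide_pos_pos zero_less_numeral)
qed

section \<open>Passage to subsequences\<close>

text \<open>Padding by zeros turns coefficients along \<open>r\<close> into coefficients for the
  whole sequence, so that estimates for \<open>b\<close> apply to \<open>b \<circ> r\<close>. A
  cut-off at \<open>r n\<close> captures exactly the first \<open>n\<close> terms of the
  subsequence.\<close>

definition spread :: "(nat \<Rightarrow> nat) \<Rightarrow> (nat \<Rightarrow> real) \<Rightarrow> nat \<Rightarrow> real" where
  "spread r c i = (if i \<in> range r then c (inv r i) else 0)"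

lemma spread_at [simp]: "strict_mono r \<Longrightarrow> spread r c (r j) = c j"
  by (simp add: spread_def strict_mono_imp_inj_on)

lemma sum_spread:
  fixes v :: "nat \<Rightarrow> 'a::real_vector"
  assumes "strict_mono r"
  shows "(\<Sum>i<r n. spread r c i *\<^sub>R v i) = (\<Sum>j<n. c j *\<^sub>R v (r j))"
proof -
  have "(\<Sum>i<r n. spread r c i *\<^sub>R v i) = (\<Sum>i\<in>r ` {..<n}. spread r c i *\<^sub>R v i)"
    using assms by (intro sum.mono_neutral_right) (auto simp: spread_def strict_mono_less)
  also have "\<dots> = (\<Sum>j<n. c j *\<^sub>R v (r j))"
    using assms by (subst sum.reindex) (auto simp: strict_mono_imp_inj_on inj_on_subset)
  finally show ?thesis .
qed

lemma summing_bound_subseq: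
  assumes "summing_bound C b" "strict_mono r"
  shows "summing_bound C (b \<circ> r)"
  unfolding summing_bound_def
proof (intro allI impI)
  fix c :: "nat \<Rightarrow> real" and m n :: nat
  assume "m \<le> n"
  then have "r m \<le> r n" using assms(2) by (simp add: strict_mono_less_eq)
  then have "norm (\<Sum>i<r m. spread r c i *\<^sub>R b i) + \<bar>\<Sum>i<r m. spread r c i\<bar>
      \<le> C * norm (\<Sum>i<r n. spread r c i *\<^sub>R b i)"
    using assms(1) by (auto simp: summing_bound_def)
  then show "norm (\<Sum>j<m. c j *\<^sub>R (b \<circ> r) j) + \<bar>\<Sum>j<m. c j\<bar> \<le> C * norm (\<Sum>j<n. c j *\<^sub>R (b \<circ> r) j)"
    using sum_spread[OF assms(2), where c = c and v = b]
      sum_spread[OF assms(2), where c = c and v = "\<lambda>_. 1 :: real"] by simp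
qed

section \<open>Biorthogonal functionals and basis expansions\<close>

lemma span_image_finite_combination:
  fixes b :: "nat \<Rightarrow> 'a::real_vector"
  assumes "w \<in> span (b ` A)"
  obtains a n where "w = (\<Sum>j<n. a j *\<^sub>R b j)" "\<And>j. j \<notin> A \<Longrightarrow> a j = 0"
proof -
  define P where "P w \<longleftrightarrow> (\<exists>a n. w = (\<Sum>j<n. a j *\<^sub>R b j) \<and> (\<forall>j. j \<notin> A \<longrightarrow> a j = 0))" for w
  have "P w"
    using assms
  proof (induction rule: span_induct_alt)
    case base
    show ?case unfolding P_def by (intro exI[of _ "\<lambda>_. 0"] exI[of _ 0]) simp
  next
    case (step c v w)
    then obtain i a n where i: "i \<in> A" "v = b i" and a: "w = (\<Sum>j<n. a j *\<^sub>R b j)" "\<forall>j. j \<notin> A \<longrightarrow> a j = 0"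
      by (auto simp: P_def)
    define N where "N = max n (Suc i)"
    have "w = (\<Sum>j<N. (if j < n then a j else 0) *\<^sub>R b j)"
      unfolding a(1) by (intro sum.mono_neutral_cong_left) (auto simp: N_def)
    moreover have "c *\<^sub>R v = (\<Sum>j<N. (if j = i then c else 0) *\<^sub>R b j)"
      unfolding i(2) by (subst sum.remove[of _ i]) (auto simp: N_def intro!: sum.neutral)
    ultimately have "c *\<^sub>R v + w = (\<Sum>j<N. ((if j = i then c else 0) + (if j < n then a j else 0)) *\<^sub>R b j)"
      by (simp add: scaleR_left_distrib sum.distrib)
    then show ?case unfolding P_def using i(1) a(2)
      by (intro exI[of _ "\<lambda>j. (if j = i then c else 0) + (if j < n then a j else 0)"] exI[of _ N]) auto
  qed
  then show ?thesis using that by (auto simp: P_def)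
qed

lemma subspace_closure:
  fixes S :: "'a::real_normed_vector set"
  assumes "subspace S"
  shows "subspace (closure S)"
  unfolding subspace_def
proof (intro conjI ballI allI)
  show "0 \<in> closure S" using subspace_0[OF assms] closure_subset by blast
next
  fix y z assume "y \<in> closure S" "z \<in> closure S"
  then obtain u v where u: "\<forall>n. u n \<in> S" "u \<longlonglongrightarrow> y" and v: "\<forall>n. v n \<in> S" "v \<longlonglongrightarrow> z"
    unfolding closure_sequential by blast
  then have "\<forall>n. u n + v n \<in> S" "(\<lambda>n. u n + v n) \<longlonglongrightarrow> y + z"
    using subspace_add[OF assms] by (auto intro: tendsto_add)
  then show "y + z \<in> closure S" unfolding closure_sequential by (intro exI[of _ "\<lambda>n. u n + v n"] conjI)
next
  fix t :: real and y assume "y \<in> closure S"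
  then obtain u where "\<forall>n. u n \<in> S" "u \<longlonglongrightarrow> y"
    unfolding closure_sequential by blast
  then have "\<forall>n. t *\<^sub>R u n \<in> S" "(\<lambda>n. t *\<^sub>R u n) \<longlonglongrightarrow> t *\<^sub>R y"
    using subspace_scale[OF assms] by (auto intro: tendsto_scaleR)
  then show "t *\<^sub>R y \<in> closure S" unfolding closure_sequential by (intro exI[of _ "\<lambda>n. t *\<^sub>R u n"] conjI)
qed

text \<open>The coefficient bound keeps \<open>b i\<close> at distance at least
  \<open>1 / (2 * C)\<close> from the span of the other terms; a functional separating the two is
  rescaled by \<open>2 * C\<close>.\<close>

lemma summing_bound_biorthogonal:
  fixes b :: "nat \<Rightarrow> 'a::real_normed_vector"
  assumes b: "summing_bound C b" and "C > 0"
  obtains g :: "nat \<Rightarrow> 'a \<Rightarrow>\<^sub>L real" where "\<And>i j. g i (b j) = (if i = j then 1 else 0)"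
proof -
  have "\<exists>g :: 'a \<Rightarrow>\<^sub>L real. \<forall>j. g (b j) = (if i = j then 1 else 0)" for i
  proof -
    let ?d = "1 / (2 * C)"
    have d: "?d \<le> norm (b i - w)" if w: "w \<in> span (b ` (- {i}))" for w
    proof -
      obtain a n where a: "w = (\<Sum>j<n. a j *\<^sub>R b j)" "\<And>j. j \<notin> - {i} \<Longrightarrow> a j = 0"
        using span_image_finite_combination[OF w] by blast
      define N where "N = max n (Suc i)"
      have "w = (\<Sum>j<N. (if j < n then a j else 0) *\<^sub>R b j)"
        unfolding a(1) by (intro sum.mono_neutral_cong_left) (auto simp: N_def)
      moreover have "b i = (\<Sum>j<N. (if j = i then 1 else 0) *\<^sub>R b j)"
        by (subst sum.remove[of _ i]) (auto simp: N_def intro!: sum.neutral)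
      ultimately have "b i - w = (\<Sum>j<N. ((if j = i then 1 else 0) - (if j < n then a j else 0)) *\<^sub>R b j)"
        by (simp add: scaleR_left_diff_distrib sum_subtractf)
      moreover have "(if i < n then a i else 0) = 0" using a(2)[of i] by simp
      ultimately have "1 \<le> 2 * C * norm (b i - w)"
        using summing_bound_coeff[OF b, of i N "\<lambda>j. (if j = i then 1 else 0) - (if j < n then a j else 0)"]
        by (simp add: less_max_iff_disj N_def)
      then show ?thesis using \<open>C > 0\<close> by (simp add: field_simps)
    qed
    have "?d \<ge> 0" using \<open>C > 0\<close> by simp
    from hahn_banach_separation[OF subspace_span this d]
    obtain f :: "'a \<Rightarrow>\<^sub>L real" where f: "\<And>w. w \<in> span (b ` (- {i})) \<Longrightarrow> f w = 0" "f (b i) = ?d" by blast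
    have "((2 * C) *\<^sub>R f) (b j) = (if i = j then 1 else 0)" for j
    proof (cases "i = j")
      case False
      then have "b j \<in> span (b ` (- {i}))" by (intro span_base) auto
      with False show ?thesis by (simp add: blinfun.scaleR_left f(1))
    qed (use f(2) \<open>C > 0\<close> in \<open>simp add: blinfun.scaleR_left\<close>)
    then show ?thesis by blast
  qed
  then show ?thesis using that by metis
qed

text \<open>The partial sum operators \<open>P m\<close> are bounded by \<open>C\<close> on the
  closed span, and each finite combination is fixed by all but finitely many of them. Convergence
  therefore extends from the dense span to its closure.\<close>

lemma summing_bound_expansion:
  fixes b :: "nat \<Rightarrow> 'a::real_normed_vector" and g :: "nat \<Rightarrow> 'a \<Rightarrow>\<^sub>L real"
  assumes b: "summing_bound C b" "C > 0"
    and g: "\<And>i j. g i (b j) = (if i = j then 1 else 0)"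
    and y: "y \<in> closure (span (range b))"
  shows "(\<lambda>j. g j y *\<^sub>R b j) sums y"
proof -
  define P where "P m z = (\<Sum>j<m. g j z *\<^sub>R b j)" for m z
  have gs: "g i (\<Sum>j<n. a j *\<^sub>R b j) = (if i < n then a i else 0)" for i n and a :: "nat \<Rightarrow> real"
    by (simp add: blinfun.sum_right blinfun.scaleR_right g if_distrib[of "times _"] sum.delta cong: if_cong)
  have P_eq: "P m (\<Sum>j<n. a j *\<^sub>R b j) = (\<Sum>j<min m n. a j *\<^sub>R b j)" for m n and a :: "nat \<Rightarrow> real"
    unfolding P_def gs by (intro sum.mono_neutral_cong_right) auto
  have span: "\<exists>a n. w = (\<Sum>j<n. a j *\<^sub>R b j)" if "w \<in> span (range b)" for w
    using span_image_finite_combination[of w b UNIV] that by blast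
  have bound: "norm (P m z) \<le> C * norm z" if "z \<in> closure (span (range b))" for m z
  proof -
    have "closed {z. norm (P m z) \<le> C * norm z}"
      unfolding P_def by (intro closed_Collect_le continuous_intros)
    moreover have "span (range b) \<subseteq> {z. norm (P m z) \<le> C * norm z}"
    proof
      fix w assume "w \<in> span (range b)"
      then obtain a n where w: "w = (\<Sum>j<n. a j *\<^sub>R b j)" using span by blast
      show "w \<in> {z. norm (P m z) \<le> C * norm z}"
        unfolding w mem_Collect_eq P_eq by (rule summing_boundD(1)[OF b(1)]) simp
    qed
    ultimately show ?thesis using that closure_minimal by blast
  qed
  have "(\<lambda>m. P m y) \<longlonglongrightarrow> y"
  proof (rule LIMSEQ_I)
    fix e :: real assume "e > 0"
    then have "e / (C + 2) > 0" using b(2) by simp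
    then obtain w where w: "w \<in> span (range b)" "dist w y < e / (C + 2)"
      using y by (auto simp: closure_approachable)
    then obtain a n where a: "w = (\<Sum>j<n. a j *\<^sub>R b j)" using span by blast
    have "y - w \<in> closure (span (range b))"
      using y w closure_subset by (intro subspace_diff[OF subspace_closure]) auto
    then have 1: "norm (P m (y - w)) \<le> C * norm (y - w)" for m by (rule bound)
    have "norm (P m y - y) < e" if "m \<ge> n" for m
    proof -
      have "P m y - y = P m (y - w) - (y - w)"
        using that P_eq[of m a n] a
        by (simp add: P_def blinfun.diff_right scaleR_left_diff_distrib sum_subtractf)
      then have "norm (P m y - y) \<le> (C + 1) * norm (y - w)"
        using norm_triangle_ineq4[of "P m (y - w)" "y - w"] 1[of m] by (simp add: algebra_simps)
      also have "\<dots> \<le> (C + 2) * norm (y - w)" by (simp add: mult_right_mono)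
      also have "\<dots> < e" using w(2) b(2) by (simp add: dist_norm norm_minus_commute field_simps)
      finally show ?thesis .
    qed
    then show "\<exists>N. \<forall>m\<ge>N. norm (P m y - y) < e" by blast
  qed
  then show ?thesis by (simp add: sums_def P_def)
qed

lemma summing_bound_basic:
  fixes b :: "nat \<Rightarrow> 'a::real_normed_vector"
  assumes b: "summing_bound C b" "C > 0"
  shows "basic_sequence b"
  unfolding basic_sequence_def
proof
  fix y assume y: "y \<in> closure (span (range b))"
  obtain g :: "nat \<Rightarrow> 'a \<Rightarrow>\<^sub>L real" where g: "\<And>i j. g i (b j) = (if i = j then 1 else 0)"
    using summing_bound_biorthogonal[OF b] by blast
  have "c = (\<lambda>j. g j y)" if c: "(\<lambda>j. c j *\<^sub>R b j) sums y" for c :: "nat \<Rightarrow> real"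
  proof
    fix i
    have "(\<lambda>j. g i (c j *\<^sub>R b j)) sums g i y"
      using c by (rule blinfun.bounded_linear_right[THEN bounded_linear.sums])
    moreover have "(\<lambda>j. g i (c j *\<^sub>R b j)) = (\<lambda>j. if j = i then c j else 0)"
      by (auto simp: blinfun.scaleR_right g)
    ultimately show "c i = g i y" using sums_single[of i c] sums_unique2 by auto
  qed
  then show "\<exists>!c :: nat \<Rightarrow> real. (\<lambda>j. c j *\<^sub>R b j) sums y"
    by (intro ex1I[of _ "\<lambda>j. g j y"] summing_bound_expansion[OF b g y])
qed

section \<open>Fragmentation by countably many functionals\<close>

definition weak_nbhd :: "'a::real_normed_vector \<Rightarrow> ('a \<Rightarrow>\<^sub>L real) set \<Rightarrow> real \<Rightarrow> 'a set" where
  "weak_nbhd p \<Phi> e = {a. \<forall>f\<in>\<Phi>. \<bar>blinfun_apply f a - blinfun_apply f p\<bar> < e}"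

lemma mem_weak_nbhd_self: "e > 0 \<Longrightarrow> p \<in> weak_nbhd p \<Phi> e"
  by (simp add: weak_nbhd_def)

lemma weak_nbhd_Un_subset:
  "weak_nbhd p (\<Phi> \<union> \<Psi>) (min d e) \<subseteq> weak_nbhd p \<Phi> d \<inter> weak_nbhd p \<Psi> e"
  by (auto simp: weak_nbhd_def)

text \<open>This is openness in the topology generated by the functionals in \<open>Y\<close>,
  expressed through basic neighbourhoods so that the families needed for different sets can be
  collected.\<close>

definition weakly_open_by :: "('a::real_normed_vector \<Rightarrow>\<^sub>L real) set \<Rightarrow> 'a set \<Rightarrow> bool" where
  "weakly_open_by Y W \<longleftrightarrow> (\<forall>p\<in>W. \<exists>\<Phi> e. finite \<Phi> \<and> \<Phi> \<subseteq> Y \<and> e > 0 \<and> weak_nbhd p \<Phi> e \<subseteq> W)"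

lemma weakly_open_by_mono: "weakly_open_by Y W \<Longrightarrow> Y \<subseteq> Z \<Longrightarrow> weakly_open_by Z W"
  unfolding weakly_open_by_def by (meson subset_trans)

lemma weakly_open_by_Union:
  assumes "\<And>W. W \<in> \<W> \<Longrightarrow> weakly_open_by Y W"
  shows "weakly_open_by Y (\<Union>\<W>)"
  unfolding weakly_open_by_def
proof
  fix p assume "p \<in> \<Union>\<W>"
  then obtain W where W: "W \<in> \<W>" "p \<in> W" by auto
  then obtain \<Phi> e where "finite \<Phi>" "\<Phi> \<subseteq> Y" "e > 0" "weak_nbhd p \<Phi> e \<subseteq> W"
    using assms[OF W(1)] unfolding weakly_open_by_def by (meson W(2))
  then show "\<exists>\<Phi> e. finite \<Phi> \<and> \<Phi> \<subseteq> Y \<and> e > 0 \<and> weak_nbhd p \<Phi> e \<subseteq> \<Union>\<W>"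
    using W(1) by blast
qed

lemma weakly_open_by_Int:
  assumes "weakly_open_by Y V" "weakly_open_by Y W"
  shows "weakly_open_by Y (V \<inter> W)"
  unfolding weakly_open_by_def
proof
  fix p assume "p \<in> V \<inter> W"
  then obtain \<Phi> d \<Psi> e where "finite \<Phi>" "\<Phi> \<subseteq> Y" "d > 0" "weak_nbhd p \<Phi> d \<subseteq> V"
    "finite \<Psi>" "\<Psi> \<subseteq> Y" "e > 0" "weak_nbhd p \<Psi> e \<subseteq> W"
    using assms unfolding weakly_open_by_def by (metis IntE)
  then show "\<exists>\<Phi> e. finite \<Phi> \<and> \<Phi> \<subseteq> Y \<and> e > 0 \<and> weak_nbhd p \<Phi> e \<subseteq> V \<inter> W"
    using weak_nbhd_Un_subset[of p \<Phi> \<Psi> d e]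
    by (intro exI[of _ "\<Phi> \<union> \<Psi>"] exI[of _ "min d e"]) auto
qed

lemma weakly_open_by_weak_nbhd:
  assumes "finite \<Phi>"
  shows "weakly_open_by \<Phi> (weak_nbhd p \<Phi> e)"
  unfolding weakly_open_by_def
proof
  fix q assume q: "q \<in> weak_nbhd p \<Phi> e"
  \<comment> \<open>The radius is the least slack left at \<open>q\<close>; the inserted 1 provides
    a minimum when \<open>\<Phi>\<close> is empty.\<close>
  define d where "d = Min (insert 1 ((\<lambda>f. e - \<bar>blinfun_apply f q - blinfun_apply f p\<bar>) ` \<Phi>))"
  have "d > 0" using q assms by (auto simp: d_def weak_nbhd_def)
  moreover have "weak_nbhd q \<Phi> d \<subseteq> weak_nbhd p \<Phi> e"
  proof
    fix a assume a: "a \<in> weak_nbhd q \<Phi> d"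
    have "\<bar>blinfun_apply f a - blinfun_apply f p\<bar> < e" if "f \<in> \<Phi>" for f
    proof -
      have "d \<le> e - \<bar>blinfun_apply f q - blinfun_apply f p\<bar>"
        unfolding d_def using that assms by (intro Min_le) auto
      moreover have "\<bar>blinfun_apply f a - blinfun_apply f q\<bar> < d" using a that by (simp add: weak_nbhd_def)
      ultimately show ?thesis by linarith
    qed
    then show "a \<in> weak_nbhd p \<Phi> e" by (simp add: weak_nbhd_def)
  qed
  ultimately show "\<exists>\<Psi> e'. finite \<Psi> \<and> \<Psi> \<subseteq> \<Phi> \<and> e' > 0 \<and> weak_nbhd q \<Psi> e' \<subseteq> weak_nbhd p \<Phi> e"
    using assms by blast
qed

lemma open_weak_nbhd:
  assumes "finite \<Phi>"
  shows "open (weak_nbhd p \<Phi> e)"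
proof -
  have "weak_nbhd p \<Phi> e = (\<Inter>f\<in>\<Phi>. {a. \<bar>blinfun_apply f a - blinfun_apply f p\<bar> < e})"
    by (auto simp: weak_nbhd_def)
  then show ?thesis using assms
    by (auto intro!: open_INT open_Collect_less continuous_intros)
qed

text \<open>Norm openness ensures that a weakly open set meeting a norm closure already meets the
  set itself; the second claim supplies neighbourhoods given by finitely many functionals.\<close>

lemma openin_weak_topologyD:
  fixes W :: "'a::real_normed_vector set"
  assumes "openin weak_topology W"
  shows "open W" "weakly_open_by UNIV W"
proof -
  let ?G = "{blinfun_apply f -` U | (f :: 'a \<Rightarrow>\<^sub>L real) U. open U}"
  have "generate_topology_on ?G W"
    using assms by (simp add: weak_topology_def openin_topology_generated_by_iff)
  then have "open W \<and> weakly_open_by UNIV W"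
  proof (induction rule: generate_topology_on.induct)
    case Empty
    show ?case by (simp add: weakly_open_by_def)
  next
    case (Int a b)
    then show ?case by (simp add: weakly_open_by_Int open_Int)
  next
    case (UN K)
    then show ?case by (simp add: weakly_open_by_Union open_Union)
  next
    case (Basis s)
    then obtain f :: "'a \<Rightarrow>\<^sub>L real" and U where s: "s = blinfun_apply f -` U" "open U" by auto
    have "weakly_open_by UNIV s"
      unfolding weakly_open_by_def
    proof
      fix p assume "p \<in> s"
      then obtain e where "e > 0" "\<And>t. dist t (blinfun_apply f p) < e \<Longrightarrow> t \<in> U"
        using s by (auto simp: open_dist)
      then show "\<exists>\<Phi> e. finite \<Phi> \<and> \<Phi> \<subseteq> UNIV \<and> e > 0 \<and> weak_nbhd p \<Phi> e \<subseteq> s"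
        by (intro exI[of _ "{f}"] exI[of _ e]) (auto simp: weak_nbhd_def s(1) dist_real_def)
    qed
    moreover have "open s"
      unfolding s(1) by (intro open_vimage s(2) continuous_intros)
    ultimately show ?case by simp
  qed
  then show "open W" "weakly_open_by UNIV W" by auto
qed

section \<open>From the PCP to fragmentation by countably many functionals\<close>

text \<open>This is norm fragmentability of \<open>B\<close> at scale \<epsilon> in the topology of
  \<open>Y\<close>. Size is measured from the centre \<open>q\<close>, which costs a factor 2
  whenever a diameter is needed.\<close>

definition fragmented_by :: "('a::real_normed_vector \<Rightarrow>\<^sub>L real) set \<Rightarrow> real \<Rightarrow> 'a set \<Rightarrow> bool" where
  "fragmented_by Y \<epsilon> B \<longleftrightarrow> (\<forall>S\<subseteq>B. S \<noteq> {} \<longrightarrow>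
     (\<exists>q\<in>S. \<exists>\<Phi> e. finite \<Phi> \<and> \<Phi> \<subseteq> Y \<and> e > 0 \<and> (\<forall>a \<in> S \<inter> weak_nbhd q \<Phi> e. dist a q \<le> \<epsilon>)))"

lemma PCP_imp_fragmented:
  fixes B :: "'a::real_normed_vector set"
  assumes "PCP TYPE('a)" "bounded B" "\<epsilon> > 0"
  shows "fragmented_by UNIV \<epsilon> B"
  unfolding fragmented_by_def
proof (intro allI impI)
  fix S assume "S \<subseteq> B" "S \<noteq> {}"
  define F where "F = closure S"
  have "F \<noteq> {}" "bounded F" "closed F"
    using \<open>S \<subseteq> B\<close> \<open>S \<noteq> {}\<close> \<open>bounded B\<close> bounded_subset by (auto simp: F_def)
  then obtain p where p: "p \<in> F"
    "topcontinuous_at (subtopology weak_topology F) (top_of_set F) (\<lambda>y. y) p"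
    using assms(1) by (auto simp: PCP_def)
  have "openin (top_of_set F) (F \<inter> ball p (\<epsilon>/2))" by (simp add: openin_open_Int)
  moreover have "p \<in> F \<inter> ball p (\<epsilon>/2)" using p(1) \<open>\<epsilon> > 0\<close> by simp
  moreover have "\<forall>V. openin (top_of_set F) V \<and> p \<in> V \<longrightarrow>
      (\<exists>U. openin (subtopology weak_topology F) U \<and> p \<in> U \<and> (\<forall>y\<in>U. y \<in> V))"
    using p(2) by (simp add: topcontinuous_at_def)
  ultimately have "\<exists>U. openin (subtopology weak_topology F) U \<and> p \<in> U \<and> (\<forall>y\<in>U. y \<in> F \<inter> ball p (\<epsilon>/2))"
    by meson
  then obtain U where U: "openin (subtopology weak_topology F) U" "p \<in> U" "U \<subseteq> ball p (\<epsilon>/2)"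
    by blast
  then obtain W where W: "openin weak_topology W" "U = W \<inter> F"
    by (auto simp: openin_subtopology)
  \<comment> \<open>The point of continuity lies only in the closure of \<open>S\<close>. Its weak
    neighbourhood is norm open, hence contains a point \<open>q\<close> of \<open>S\<close>, which
    serves as the new centre at the cost of doubling the radius.\<close>
  have "W \<inter> S \<noteq> {}"
    using open_Int_closure_eq_empty[OF openin_weak_topologyD(1)[OF W(1)], of S] U(2) W(2)
    by (auto simp: F_def)
  then obtain q where q: "q \<in> W" "q \<in> S" by auto
  then obtain \<Phi> e where \<Phi>: "finite \<Phi>" "e > 0" "weak_nbhd q \<Phi> e \<subseteq> W"
    using openin_weak_topologyD(2)[OF W(1)] by (auto simp: weakly_open_by_def)
  have ball: "a \<in> ball p (\<epsilon>/2)" if "a \<in> W" "a \<in> S" for a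
    using that U(3) W(2) closure_subset[of S] by (auto simp: F_def)
  have "dist a q \<le> \<epsilon>" if "a \<in> S \<inter> weak_nbhd q \<Phi> e" for a
    using ball[of a] ball[OF q] that \<Phi>(3) dist_triangle[of a q p] by (auto simp: dist_commute)
  then show "\<exists>q\<in>S. \<exists>\<Phi> e. finite \<Phi> \<and> \<Phi> \<subseteq> UNIV \<and> e > 0 \<and> (\<forall>a \<in> S \<inter> weak_nbhd q \<Phi> e. dist a q \<le> \<epsilon>)"
    using q(2) \<Phi>(1,2) by blast
qed

text \<open>Balls with centres in \<open>D\<close> and radii \<open>inverse (real (Suc n))\<close>
  are countably many; one member of the family is chosen for each ball that fits into some
  member.\<close>

lemma Lindelof_separable:
  fixes B :: "'a::metric_space set"
  assumes "countable D" "B \<subseteq> closure D" and op: "\<And>W. W \<in> \<W> \<Longrightarrow> open W"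
  obtains \<V> where "\<V> \<subseteq> \<W>" "countable \<V>" "B \<inter> \<Union>\<W> \<subseteq> \<Union>\<V>"
proof -
  define Q where "Q = {(d, n :: nat). d \<in> D \<and> (\<exists>W\<in>\<W>. ball d (inverse (real (Suc n))) \<subseteq> W)}"
  define g where "g = (\<lambda>(d, n :: nat). SOME W. W \<in> \<W> \<and> ball d (inverse (real (Suc n))) \<subseteq> W)"
  have g: "g (d, n) \<in> \<W> \<and> ball d (inverse (real (Suc n))) \<subseteq> g (d, n)" if "(d, n) \<in> Q" for d n
    using that unfolding Q_def g_def by (auto intro: someI2_ex)
  show ?thesis
  proof
    show "g ` Q \<subseteq> \<W>" using g by force
    have "Q \<subseteq> D \<times> UNIV" by (auto simp: Q_def)
    then show "countable (g ` Q)" using assms(1) 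
      by (intro countable_image countable_subset[of Q "D \<times> UNIV"]) auto
    show "B \<inter> \<Union>\<W> \<subseteq> \<Union>(g ` Q)"
    proof
      fix b assume "b \<in> B \<inter> \<Union>\<W>"
      then obtain W where W: "b \<in> B" "W \<in> \<W>" "b \<in> W" by auto
      then obtain e where e: "e > 0" "ball b e \<subseteq> W" using op open_contains_ball by blast
      obtain n where n: "inverse (real (Suc n)) < e / 2" using reals_Archimedean[of "e/2"] e by auto
      have "b \<in> closure D" using W(1) assms(2) by auto
      then obtain d where d: "d \<in> D" "dist d b < inverse (real (Suc n))"
        using closure_approachable by (metis inverse_positive_iff_positive of_nat_0_less_iff zero_less_Suc)
      have "ball d (inverse (real (Suc n))) \<subseteq> ball b e"
      proof
        fix a assume "a \<in> ball d (inverse (real (Suc n)))"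
        then show "a \<in> ball b e"
          using n d(2) dist_triangle[of b a d] by (simp add: dist_commute)
      qed
      then have "(d, n) \<in> Q" using d(1) W(2) e(2) by (auto simp: Q_def)
      with g[OF this] d(2) show "b \<in> \<Union>(g ` Q)" by fastforce
    qed
  qed
qed

text \<open>A small relative neighbourhood in \<open>S \<inter> W\<close> becomes one in
  \<open>S\<close> after intersection with a neighbourhood inside \<open>W\<close>.\<close>

lemma fragmented_by_meets:
  assumes "fragmented_by Y \<epsilon> (B \<inter> W)" "weakly_open_by Y W" "S \<subseteq> B" "S \<inter> W \<noteq> {}"
  shows "\<exists>q\<in>S. \<exists>\<Phi> e. finite \<Phi> \<and> \<Phi> \<subseteq> Y \<and> e > 0 \<and> (\<forall>a \<in> S \<inter> weak_nbhd q \<Phi> e. dist a q \<le> \<epsilon>)"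
proof -
  have "S \<inter> W \<subseteq> B \<inter> W" using assms(3) by auto
  then obtain q \<Phi> d where q: "q \<in> S \<inter> W" "finite \<Phi>" "\<Phi> \<subseteq> Y" "d > 0"
    "\<forall>a \<in> S \<inter> W \<inter> weak_nbhd q \<Phi> d. dist a q \<le> \<epsilon>"
    using assms(1,4) unfolding fragmented_by_def by metis
  obtain \<Psi> e where "finite \<Psi>" "\<Psi> \<subseteq> Y" "e > 0" "weak_nbhd q \<Psi> e \<subseteq> W"
    using assms(2) q(1) unfolding weakly_open_by_def by (metis IntE)
  moreover from this have "\<forall>a \<in> S \<inter> weak_nbhd q (\<Phi> \<union> \<Psi>) (min d e). dist a q \<le> \<epsilon>"
    using q(5) weak_nbhd_Un_subset[of q \<Phi> \<Psi> d e] by blast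
  ultimately show ?thesis
    using q(1-4) by (intro bexI[of _ q] exI[of _ "\<Phi> \<union> \<Psi>"] exI[of _ "min d e"]) auto
qed

lemma fragmented_by_mono: "fragmented_by Y \<epsilon> B \<Longrightarrow> Y \<subseteq> Z \<Longrightarrow> fragmented_by Z \<epsilon> B"
  unfolding fragmented_by_def by (meson subset_trans)

text \<open>The union of all open sets on which countably many functionals suffice is again such a set
  by the Lindelof property; the weakly open set provided by the PCP for its complement would
  enlarge it.\<close>

lemma PCP_fragmented_by_countable:
  fixes B :: "'a::real_normed_vector set"
  assumes "PCP TYPE('a)" "bounded B" "\<epsilon> > 0" "countable D" "B \<subseteq> closure D"
  obtains Y where "countable Y" "fragmented_by Y \<epsilon> B"
proof -
  define \<W> where "\<W> = {W. open W \<and> (\<exists>Y. countable Y \<and> weakly_open_by Y W \<and> fragmented_by Y \<epsilon> (B \<inter> W))}"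
  obtain \<V> where \<V>: "\<V> \<subseteq> \<W>" "countable \<V>" "B \<inter> \<Union>\<W> \<subseteq> \<Union>\<V>"
    using Lindelof_separable[OF assms(4,5), of \<W>] by (auto simp: \<W>_def)
  have "\<forall>W\<in>\<V>. \<exists>Y. countable Y \<and> weakly_open_by Y W \<and> fragmented_by Y \<epsilon> (B \<inter> W)"
    using \<V>(1) by (auto simp: \<W>_def)
  then obtain y where y: "\<And>W. W \<in> \<V> \<Longrightarrow> countable (y W)" "\<And>W. W \<in> \<V> \<Longrightarrow> weakly_open_by (y W) W"
    "\<And>W. W \<in> \<V> \<Longrightarrow> fragmented_by (y W) \<epsilon> (B \<inter> W)" by metis
  define Y where "Y = (\<Union>W\<in>\<V>. y W)"
  define U where "U = \<Union>\<V>"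
  have "countable Y" using \<V>(2) y(1) by (auto simp: Y_def)
  have yY: "y W \<subseteq> Y" if "W \<in> \<V>" for W using that by (auto simp: Y_def)
  have wo: "weakly_open_by Y W" if "W \<in> \<V>" for W using weakly_open_by_mono y(2) yY that by blast
  then have woU: "weakly_open_by Y U" unfolding U_def by (rule weakly_open_by_Union)
  have frU: "fragmented_by Y \<epsilon> (B \<inter> U)"
    unfolding fragmented_by_def
  proof (intro allI impI)
    fix S assume S: "S \<subseteq> B \<inter> U" "S \<noteq> {}"
    then obtain p where "p \<in> S" "p \<in> U" by blast
    then obtain W where W: "W \<in> \<V>" "S \<inter> W \<noteq> {}" unfolding U_def by blast
    have "fragmented_by Y \<epsilon> (B \<inter> W)" using fragmented_by_mono y(3) yY W(1) by blast
    from fragmented_by_meets[OF this wo[OF W(1)] _ W(2)] S(1)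
    show "\<exists>q\<in>S. \<exists>\<Phi> e. finite \<Phi> \<and> \<Phi> \<subseteq> Y \<and> e > 0 \<and> (\<forall>a \<in> S \<inter> weak_nbhd q \<Phi> e. dist a q \<le> \<epsilon>)"
      by blast
  qed
  have "B \<subseteq> U"
  proof (rule ccontr)
    assume "\<not> B \<subseteq> U"
    then have "B - U \<noteq> {}" by auto
    \<comment> \<open>Half the scale is used because a subset of \<open>W\<close> that misses
      \<open>U\<close> is close to \<open>q\<close> without necessarily containing it; any of its
      points then works as centre at scale \<epsilon>.\<close>
    moreover have "fragmented_by UNIV (\<epsilon>/2) B" using assms by (intro PCP_imp_fragmented) auto
    ultimately obtain q \<Phi> e where q: "q \<in> B - U" "finite \<Phi>" "e > 0"
      "\<forall>a \<in> (B - U) \<inter> weak_nbhd q \<Phi> e. dist a q \<le> \<epsilon>/2"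
      unfolding fragmented_by_def by (metis Diff_subset)
    define W where "W = weak_nbhd q \<Phi> e"
    have "fragmented_by (Y \<union> \<Phi>) \<epsilon> (B \<inter> W)"
      unfolding fragmented_by_def
    proof (intro allI impI)
      fix S assume S: "S \<subseteq> B \<inter> W" "S \<noteq> {}"
      show "\<exists>q\<in>S. \<exists>\<Psi> e. finite \<Psi> \<and> \<Psi> \<subseteq> Y \<union> \<Phi> \<and> e > 0 \<and> (\<forall>a \<in> S \<inter> weak_nbhd q \<Psi> e. dist a q \<le> \<epsilon>)"
      proof (cases "S \<inter> U = {}")
        case True
        have near: "dist a q \<le> \<epsilon>/2" if "a \<in> S" for a using q(4) that S True by (auto simp: W_def)
        have "dist a p \<le> \<epsilon>" if "a \<in> S" "p \<in> S" for a p
          using near[OF that(1)] near[OF that(2)] dist_triangle[of a p q] by (simp add: dist_commute)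
        with S(2) show ?thesis by (metis IntD1 empty_subsetI finite.emptyI ex_in_conv zero_less_one)
      next
        case False
        have "S \<subseteq> B" using S(1) by auto
        from fragmented_by_meets[OF frU woU this False] show ?thesis by (meson le_supI1)
      qed
    qed
    moreover have "weakly_open_by (Y \<union> \<Phi>) W"
      unfolding W_def using weakly_open_by_mono[OF weakly_open_by_weak_nbhd[OF q(2)]] by auto
    moreover have "open W" unfolding W_def by (rule open_weak_nbhd[OF q(2)])
    moreover have "countable (Y \<union> \<Phi>)" using \<open>countable Y\<close> q(2) by (simp add: countable_finite)
    ultimately have "W \<in> \<W>" unfolding \<W>_def by blast
    moreover have "q \<in> W" unfolding W_def using q(3) by (rule mem_weak_nbhd_self)
    ultimately show False using q(1) \<V>(3) by (auto simp: U_def)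
  qed
  then have "fragmented_by Y \<epsilon> B" using frU by (simp add: Int_absorb2)
  then show ?thesis using \<open>countable Y\<close> that by blast
qed

section \<open>The image of the ball in the space of real sequences\<close>

lemma fsigma_open: "open (V :: 'a::metric_space set) \<Longrightarrow> fsigma_in euclidean V"
  by (metis Met_TC.metrizable_space_mtopology mtopology_is_euclidean open_imp_fsigma_in open_openin)

lemma fsigma_closed: "closed (V :: 'a::metric_space set) \<Longrightarrow> fsigma_in euclidean V"
  by (simp add: closed_imp_fsigma_in)

text \<open>Enumerating the functionals maps \<open>B\<close> into the second countable metrizable
  space of real sequences. Closedness of \<open>B\<close> will return limits of Cauchy sequences to
  \<open>B\<close>.\<close>

locale countably_fragmented =
  fixes y :: "nat \<Rightarrow> 'a::banach \<Rightarrow>\<^sub>L real" and B :: "'a set"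
  assumes closed_B: "closed B"
    and fragmented: "\<And>\<epsilon>. \<epsilon> > 0 \<Longrightarrow> fragmented_by (range y) \<epsilon> B"
begin

definition evals :: "'a \<Rightarrow> nat \<Rightarrow> real" where
  "evals a = (\<lambda>n. y n a)"

lemma continuous_evals: "continuous_on S evals"
  unfolding evals_def by (intro continuous_on_coordinatewise_then_product continuous_intros)

definition small :: "real \<Rightarrow> (nat \<Rightarrow> real) set \<Rightarrow> bool" where
  "small \<epsilon> Q \<longleftrightarrow> (\<forall>a\<in>B. \<forall>a'\<in>B. evals a \<in> Q \<longrightarrow> evals a' \<in> Q \<longrightarrow> dist a a' \<le> \<epsilon>)"

text \<open>A decomposition of \<open>P\<close> into pieces of small preimage and a part that misses the image
  of \<open>B\<close>. The image is required to be dense in each piece, so that a point lying in a decreasing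
  sequence of pieces is a limit of points of the image.\<close>

definition splits :: "real \<Rightarrow> (nat \<Rightarrow> real) set \<Rightarrow> bool" where
  "splits \<epsilon> P \<longleftrightarrow> (\<exists>E Q. fsigma_in euclidean E \<and> E \<inter> evals ` B = {} \<and>
     (\<forall>i :: nat. fsigma_in euclidean (Q i) \<and> Q i \<subseteq> closure (evals ` B \<inter> Q i) \<and> small \<epsilon> (Q i)) \<and>
     P = E \<union> (\<Union>i. Q i))"

lemma splits_empty: "splits \<epsilon> {}"
  unfolding splits_def by (intro exI[of _ "{}"] exI[of _ "\<lambda>_. {}"]) (auto simp: small_def)

lemma splits_UN:
  assumes "\<And>i :: nat. splits \<epsilon> (P i)"
  shows "splits \<epsilon> (\<Union>i. P i)"
proof -
  from assms obtain E Q where E: "\<And>i. fsigma_in euclidean (E i)" "\<And>i. E i \<inter> evals ` B = {}"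
    and Q: "\<And>i j. fsigma_in euclidean (Q i j) \<and> Q i j \<subseteq> closure (evals ` B \<inter> Q i j) \<and> small \<epsilon> (Q i j)"
    and P: "\<And>i. P i = E i \<union> (\<Union>j :: nat. Q i j)"
    unfolding splits_def by metis
  show ?thesis
    unfolding splits_def
  proof (intro exI[of _ "\<Union>i. E i"] exI[of _ "\<lambda>n. case prod_decode n of (i, j) \<Rightarrow> Q i j"] conjI allI)
    show "fsigma_in euclidean (\<Union>i. E i)" using E by (intro fsigma_in_Union) auto
    show "(\<Union>i. E i) \<inter> evals ` B = {}" using E(2) by blast
    show "(\<Union>i. P i) = (\<Union>i. E i) \<union> (\<Union>n. case prod_decode n of (i, j) \<Rightarrow> Q i j)" (is "?L = ?R")
    proof
      show "?L \<subseteq> ?R"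
      proof
        fix z assume "z \<in> ?L"
        then obtain i where "z \<in> E i \<or> (\<exists>j. z \<in> Q i j)" using P by auto
        moreover have "z \<in> ?R" if "z \<in> Q i j" for j
          using that by (intro UnI2 UN_I[of "prod_encode (i, j)"]) auto
        ultimately show "z \<in> ?R" by blast
      qed
      show "?R \<subseteq> ?L" using P by (auto split: prod.splits)
    qed
  qed (use Q in \<open>auto split: prod.splits\<close>)
qed

lemma splits_Un:
  assumes "splits \<epsilon> P" "splits \<epsilon> P'"
  shows "splits \<epsilon> (P \<union> P')"
proof -
  have "splits \<epsilon> (\<Union>i :: nat. if i = 0 then P else P')" using assms by (intro splits_UN) auto
  also have "(\<Union>i :: nat. if i = 0 then P else P') = P \<union> P'" by (auto split: if_splits)
  finally show ?thesis .
qed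

lemma splits_Int_open:
  assumes "splits \<epsilon> P" "open V"
  shows "splits \<epsilon> (P \<inter> V)"
proof -
  from assms(1) obtain E Q where E: "fsigma_in euclidean E" "E \<inter> evals ` B = {}"
    and Q: "\<And>j. fsigma_in euclidean (Q j)" "\<And>j. Q j \<subseteq> closure (evals ` B \<inter> Q j)" "\<And>j. small \<epsilon> (Q j)"
    and P: "P = E \<union> (\<Union>j :: nat. Q j)"
    unfolding splits_def by metis
  show ?thesis
    unfolding splits_def
  proof (intro exI[of _ "E \<inter> V"] exI[of _ "\<lambda>j. Q j \<inter> V"] conjI allI)
    show "fsigma_in euclidean (E \<inter> V)" using E assms(2) by (simp add: fsigma_in_Int fsigma_open fsigma_closed open_Compl)
    show "fsigma_in euclidean (Q j \<inter> V)" for j using Q assms(2) by (simp add: fsigma_in_Int fsigma_open fsigma_closed open_Compl)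
    \<comment> \<open>Openness of \<open>V\<close> keeps the image dense in the smaller
      piece.\<close>
    show "Q j \<inter> V \<subseteq> closure (evals ` B \<inter> (Q j \<inter> V))" for j
    proof -
      have "Q j \<inter> V \<subseteq> closure (evals ` B \<inter> Q j) \<inter> V" using Q(2)[of j] by auto
      also have "\<dots> \<subseteq> closure (evals ` B \<inter> Q j \<inter> V)"
        using open_Int_closure_subset[OF assms(2), of "evals ` B \<inter> Q j"] by (simp add: Int_commute)
      finally show ?thesis by (simp add: Int_assoc)
    qed
    show "small \<epsilon> (Q j \<inter> V)" for j using Q(3)[of j] by (auto simp: small_def)
    show "E \<inter> V \<inter> evals ` B = {}" using E by auto
    show "P \<inter> V = E \<inter> V \<union> (\<Union>j. Q j \<inter> V)" using P by auto
  qed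
qed

text \<open>A neighbourhood given by finitely many of the functionals is the preimage of an open
  cylinder under \<open>evals\<close>.\<close>

lemma small_open:
  assumes "\<epsilon> > 0" "S \<subseteq> B" "S \<noteq> {}"
  obtains V a where "open V" "a \<in> S" "evals a \<in> V"
    "\<And>a a'. a \<in> S \<Longrightarrow> a' \<in> S \<Longrightarrow> evals a \<in> V \<Longrightarrow> evals a' \<in> V \<Longrightarrow> dist a a' \<le> \<epsilon>"
proof -
  have "fragmented_by (range y) (\<epsilon>/2) B" using assms(1) by (intro fragmented) auto
  then obtain q \<Phi> e where q: "q \<in> S" "finite \<Phi>" "\<Phi> \<subseteq> range y" "e > 0"
    "\<forall>a \<in> S \<inter> weak_nbhd q \<Phi> e. dist a q \<le> \<epsilon>/2"
    using assms(2,3) unfolding fragmented_by_def by metis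
  obtain I where I: "finite I" "\<Phi> = y ` I" using q(2,3) finite_subset_image[of \<Phi> y UNIV] by auto
  define V where "V = (\<Inter>n\<in>I. {z :: nat \<Rightarrow> real. \<bar>z n - y n q\<bar> < e})"
  have near: "dist a q \<le> \<epsilon>/2" if "a \<in> S" "evals a \<in> V" for a
    using q(5) that by (auto simp: V_def evals_def I(2) weak_nbhd_def)
  show ?thesis
  proof
    show "open V"
      unfolding V_def using I(1) by (intro open_INT ballI open_Collect_less continuous_intros) auto
    show "evals q \<in> V" using q(4) by (auto simp: V_def evals_def)
    show "dist a a' \<le> \<epsilon>" if "a \<in> S" "a' \<in> S" "evals a \<in> V" "evals a' \<in> V" for a a'
      using near[of a] near[of a'] that dist_triangle[of a a' q] by (simp add: dist_commute)
  qed (rule q(1))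
qed

text \<open>The open sets on which \<open>P\<close> splits have a union \<open>U\<close> that is a
  countable subunion, so \<open>P\<close> splits on \<open>U\<close>. If the rest of
  \<open>P\<close> still met the image, fragmentation of its preimage would produce a further open
  set of this kind that is not contained in \<open>U\<close>.\<close>

lemma fsigma_splits:
  assumes P: "fsigma_in euclidean P" and "\<epsilon> > 0"
  shows "splits \<epsilon> P"
proof -
  define \<V> where "\<V> = {V. open V \<and> splits \<epsilon> (P \<inter> V)}"
  obtain \<F> where \<F>: "\<F> \<subseteq> \<V>" "countable \<F>" "\<Union>\<F> = \<Union>\<V>"
    using Lindelof[of \<V>] by (auto simp: \<V>_def)
  define U where "U = \<Union>\<F>"
  have "open U" using \<F>(1) by (auto simp: U_def \<V>_def)
  have U: "splits \<epsilon> (P \<inter> U)"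
  proof (cases "\<F> = {}")
    case True
    then show ?thesis by (simp add: U_def splits_empty)
  next
    case False
    have "splits \<epsilon> (P \<inter> from_nat_into \<F> i)" for i
      using from_nat_into[OF False] \<F>(1) by (auto simp: \<V>_def)
    then have "splits \<epsilon> (\<Union>i. P \<inter> from_nat_into \<F> i)" by (rule splits_UN)
    also have "(\<Union>i. P \<inter> from_nat_into \<F> i) = P \<inter> U"
      using range_from_nat_into[OF False \<F>(2)] by (auto simp: U_def)
    finally show ?thesis .
  qed
  define P' where "P' = P \<inter> - U"
  have P': "fsigma_in euclidean P'"
    unfolding P'_def using P \<open>open U\<close> by (simp add: fsigma_in_Int fsigma_closed closed_Compl)
  have "evals ` B \<inter> P' = {}"
  proof (rule ccontr)
    assume "evals ` B \<inter> P' \<noteq> {}"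
    define S where "S = {a \<in> B. evals a \<in> P'}"
    have "S \<subseteq> B" "S \<noteq> {}" using \<open>evals ` B \<inter> P' \<noteq> {}\<close> by (auto simp: S_def)
    from small_open[OF \<open>\<epsilon> > 0\<close> this] obtain V a where V: "open V" "a \<in> S" "evals a \<in> V"
      "\<And>a a'. a \<in> S \<Longrightarrow> a' \<in> S \<Longrightarrow> evals a \<in> V \<Longrightarrow> evals a' \<in> V \<Longrightarrow> dist a a' \<le> \<epsilon>"
      by blast
    \<comment> \<open>Cutting along the closure of the image points \<open>R\<close> leaves one part
      without image points and one in which they are dense.\<close>
    define R where "R = evals ` B \<inter> (P' \<inter> V)"
    have "R \<subseteq> closure R" by (rule closure_subset)
    have "splits \<epsilon> (P' \<inter> V)"
      unfolding splits_def
    proof (intro exI[of _ "P' \<inter> V \<inter> - closure R"] exI[of _ "\<lambda>_. P' \<inter> V \<inter> closure R"] conjI allI)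
      show "fsigma_in euclidean (P' \<inter> V \<inter> - closure R)"
        using P' V(1) by (simp add: fsigma_in_Int fsigma_open fsigma_closed open_Compl)
      show "fsigma_in euclidean (P' \<inter> V \<inter> closure R)"
        using P' V(1) by (simp add: fsigma_in_Int fsigma_open fsigma_closed open_Compl)
      show "P' \<inter> V \<inter> - closure R \<inter> evals ` B = {}" using \<open>R \<subseteq> closure R\<close> by (auto simp: R_def)
      have "evals ` B \<inter> (P' \<inter> V \<inter> closure R) = R" using \<open>R \<subseteq> closure R\<close> by (auto simp: R_def)
      then show "P' \<inter> V \<inter> closure R \<subseteq> closure (evals ` B \<inter> (P' \<inter> V \<inter> closure R))" by auto
      show "small \<epsilon> (P' \<inter> V \<inter> closure R)" using V(4) by (auto simp: small_def S_def)
    qed auto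
    then have "splits \<epsilon> ((P \<inter> U) \<inter> V \<union> P' \<inter> V)"
      using splits_Int_open[OF U V(1)] by (intro splits_Un)
    also have "(P \<inter> U) \<inter> V \<union> P' \<inter> V = P \<inter> V" by (auto simp: P'_def)
    finally have "V \<in> \<V>" using V(1) by (simp add: \<V>_def)
    then have "evals a \<in> U" using V(3) \<F>(3) by (auto simp: U_def)
    then show False using V(2) by (auto simp: P'_def S_def)
  qed
  then have "splits \<epsilon> P'"
    unfolding splits_def using P'
    by (intro exI[of _ P'] exI[of _ "\<lambda>_. {}"]) (auto simp: small_def)
  with U have "splits \<epsilon> (P \<inter> U \<union> P')" by (rule splits_Un)
  then show ?thesis by (simp add: P'_def flip: Int_Un_distrib)
qed

text \<open>Splitting is iterated at the scales \<open>(1/2)^n\<close> along a countable tree, and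
  the discarded parts are collected. A point that is never discarded follows an infinite branch;
  nearby image points in the pieces of the branch have Cauchy preimages, whose limit is mapped to
  the point.\<close>

lemma complement_of_image_fsigma: "fsigma_in euclidean (- evals ` B)"
proof -
  define D where "D n P E Q \<longleftrightarrow> fsigma_in euclidean E \<and> E \<inter> evals ` B = {} \<and>
     (\<forall>i :: nat. fsigma_in euclidean (Q i) \<and> Q i \<subseteq> closure (evals ` B \<inter> Q i) \<and> small ((1/2)^n) (Q i)) \<and>
     P = E \<union> (\<Union>i. Q i)" for n :: nat and P E Q
  define EQ where "EQ n P = (SOME p. D n P (fst p) (snd p))" for n P
  define E where "E n P = fst (EQ n P)" for n P
  define Q where "Q n P = snd (EQ n P)" for n P
  have EQ: "D n P (E n P) (Q n P)" if "fsigma_in euclidean P" for n P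
  proof -
    have "\<exists>p. D n P (fst p) (snd p)"
      using fsigma_splits[OF that, of "(1/2)^n"] by (auto simp: splits_def D_def)
    then show ?thesis unfolding E_def Q_def EQ_def by (rule someI_ex)
  qed
  have E: "fsigma_in euclidean (E n P)" "E n P \<inter> evals ` B = {}"
    and Q: "fsigma_in euclidean (Q n P i)" "Q n P i \<subseteq> closure (evals ` B \<inter> Q n P i)"
      "small ((1/2)^n) (Q n P i)"
    and PEQ: "P = E n P \<union> (\<Union>i. Q n P i)" if "fsigma_in euclidean P" for n P i
    using EQ[OF that, of n] unfolding D_def by blast+
  \<comment> \<open>Lists grow at the front: \<open>i # l\<close> is the \<open>i\<close>-th child
    of \<open>l\<close>, and the length of \<open>l\<close> fixes the scale of the
    splitting.\<close>
  define node where "node = rec_list UNIV (\<lambda>i l N. Q (length l) N (i :: nat))"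
  have node: "node [] = UNIV" "node (i # l) = Q (length l) (node l) i" for i l
    by (simp_all add: node_def)
  have fn: "fsigma_in euclidean (node l)" for l
    by (induction l) (auto simp: node Q fsigma_closed)
  define F where "F = (\<Union>l. E (length l) (node l))"
  have "fsigma_in euclidean F" unfolding F_def using E(1)[OF fn] by (intro fsigma_in_Union) auto
  moreover have "F \<inter> evals ` B = {}" using E(2)[OF fn] by (auto simp: F_def)
  moreover have "z \<in> evals ` B" if "z \<notin> F" for z
  proof -
    have "\<exists>L. \<forall>n. (length (L n) = n \<and> z \<in> node (L n)) \<and> (\<exists>i. L (Suc n) = i # L n)"
    proof (rule dependent_nat_choice)
      show "\<exists>l. length l = 0 \<and> z \<in> node l" by (simp add: node)
    next
      fix l n assume l: "length l = n \<and> z \<in> node l"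
      then have "z \<notin> E n (node l)" using that by (auto simp: F_def)
      then obtain i where "z \<in> Q n (node l) i" using l PEQ[OF fn, of l n] by blast
      then show "\<exists>l'. (length l' = Suc n \<and> z \<in> node l') \<and> (\<exists>i. l' = i # l)"
        using l by (intro exI[of _ "i # l"]) (simp add: node)
    qed
    then obtain L where L: "\<And>n. length (L n) = n" "\<And>n. z \<in> node (L n)"
      "\<And>n. \<exists>i. L (Suc n) = i # L n" by blast
    have LQ: "\<exists>i. node (L (Suc n)) = Q n (node (L n)) i" for n
      using L(3)[of n] L(1)[of n] by (auto simp: node)
    have "node (L (Suc n)) \<subseteq> node (L n)" for n
      using LQ[of n] PEQ[OF fn, of "L n" n] by blast
    then have anti: "node (L m) \<subseteq> node (L n)" if "n \<le> m" for m n
      using lift_Suc_antimono_le[of "\<lambda>n. node (L n)"] that by blast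
    have "\<exists>a\<in>B. evals a \<in> node (L (Suc n)) \<and> dist (evals a) z < (1/2)^n" for n
    proof -
      obtain i where i: "node (L (Suc n)) = Q n (node (L n)) i" using LQ by blast
      have "z \<in> closure (evals ` B \<inter> node (L (Suc n)))"
        using L(2)[of "Suc n"] Q(2)[OF fn, of n "L n" i] unfolding i by (rule rev_subsetD)
      then obtain w where "w \<in> evals ` B \<inter> node (L (Suc n))" "dist w z < (1/2)^n"
        unfolding closure_approachable by (meson half_gt_zero_iff zero_less_divide_1_iff zero_less_numeral zero_less_power)
      then show ?thesis by auto
    qed
    then obtain a where a: "\<And>n. a n \<in> B" "\<And>n. evals (a n) \<in> node (L (Suc n))"
      "\<And>n. dist (evals (a n)) z < (1/2)^n" by metis
    have close: "dist (a m) (a k) \<le> (1/2)^n" if "n \<le> m" "n \<le> k" for m k n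
    proof -
      have "evals (a m) \<in> node (L (Suc n))" "evals (a k) \<in> node (L (Suc n))"
        using anti[of "Suc n" "Suc m"] anti[of "Suc n" "Suc k"] a(2) that by auto
      then show ?thesis using LQ[of n] Q(3)[OF fn, of n "L n"] a(1) by (auto simp: small_def)
    qed
    have "Cauchy a"
    proof (rule metric_CauchyI)
      fix e :: real assume "e > 0"
      then obtain n where "(1/2)^n < e" using real_arch_pow_inv[of e "1/2"] by auto
      then show "\<exists>M. \<forall>m\<ge>M. \<forall>k\<ge>M. dist (a m) (a k) < e" using close by (meson le_less_trans)
    qed
    then obtain l where l: "a \<longlonglongrightarrow> l" using Cauchy_convergent_iff convergent_def by blast
    then have "l \<in> B" using closed_B a(1) closed_sequentially by blast
    have "(\<lambda>n. evals (a n)) \<longlonglongrightarrow> evals l"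
      using continuous_evals[of UNIV] l by (simp add: continuous_on_tendsto_compose)
    moreover have "(\<lambda>n. evals (a n)) \<longlonglongrightarrow> z"
    proof (rule metric_LIMSEQ_I)
      fix e :: real assume "e > 0"
      then obtain n where n: "(1/2)^n < e" using real_arch_pow_inv[of e "1/2"] by auto
      have "dist (evals (a m)) z < e" if "m \<ge> n" for m
      proof -
        have "(1/2 :: real)^m \<le> (1/2)^n" using that by (intro power_decreasing) auto
        then show ?thesis using a(3)[of m] n by linarith
      qed
      then show "\<exists>N. \<forall>m\<ge>N. dist (evals (a m)) z < e" by blast
    qed
    ultimately have "evals l = z" by (rule LIMSEQ_unique)
    then show ?thesis using \<open>l \<in> B\<close> by auto
  qed
  ultimately have "F = - evals ` B" by auto
  with \<open>fsigma_in euclidean F\<close> show ?thesis by simp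
qed

end

section \<open>Bounded completeness\<close>

lemma closed_span_separable:
  fixes x :: "nat \<Rightarrow> 'a::real_normed_vector"
  obtains D where "countable D" "closure (span (range x)) \<subseteq> closure D"
proof -
  define D where "D = (\<lambda>l :: rat list. \<Sum>j<length l. real_of_rat (l ! j) *\<^sub>R x j) ` UNIV"
  have "w \<in> closure D" if w_span: "w \<in> span (range x)" for w
  proof -
    obtain a n where w: "w = (\<Sum>j<n. a j *\<^sub>R x j)"
      using w_span by (rule span_image_finite_combination)
    have ex: "\<exists>\<rho>. (\<lambda>k. real_of_rat (\<rho> k)) \<longlonglongrightarrow> a j" for j
    proof -
      have "a j \<in> closure (range real_of_rat)" using Rats_closure_real by (auto simp: Rats_def)
      then obtain u where u: "\<forall>k. u k \<in> range real_of_rat" "u \<longlonglongrightarrow> a j"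
        unfolding closure_sequential by blast
      then have "\<forall>k. \<exists>\<rho>. u k = real_of_rat \<rho>" by blast
      then obtain \<rho> where "\<forall>k. u k = real_of_rat (\<rho> k)" by (rule choice[THEN exE])
      then have "u = (\<lambda>k. real_of_rat (\<rho> k))" by (simp add: fun_eq_iff)
      with u(2) show ?thesis by blast
    qed
    obtain \<rho> where \<rho>: "\<And>j. (\<lambda>k. real_of_rat (\<rho> j k)) \<longlonglongrightarrow> a j"
      using choice[of "\<lambda>j \<rho>. (\<lambda>k. real_of_rat (\<rho> k)) \<longlonglongrightarrow> a j"] ex by blast
    have "(\<lambda>k. \<Sum>j<n. real_of_rat (\<rho> j k) *\<^sub>R x j) \<longlonglongrightarrow> w"
      unfolding w by (intro tendsto_sum tendsto_scaleR \<rho> tendsto_const)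
    moreover have "(\<Sum>j<n. real_of_rat (\<rho> j k) *\<^sub>R x j) \<in> D" for k
      unfolding D_def by (rule image_eqI[of _ _ "map (\<lambda>j. \<rho> j k) [0..<n]"]) auto
    ultimately show ?thesis
      unfolding closure_sequential by (intro exI[of _ "\<lambda>k. \<Sum>j<n. real_of_rat (\<rho> j k) *\<^sub>R x j"]) auto
  qed
  then have "closure (span (range x)) \<subseteq> closure D" by (intro closure_minimal) auto
  moreover have "countable D" by (simp add: D_def)
  ultimately show ?thesis using that by blast
qed

text \<open>The two sets have positive distance in the product metric, and up to a small remainder
  this metric is determined by finitely many coordinates.\<close>

lemma compact_closed_coordinate_gap:
  fixes A F :: "(nat \<Rightarrow> real) set"
  assumes "compact A" "closed F" "A \<inter> F = {}"
  obtains I \<delta> where "finite I" "\<delta> > 0" "\<And>p z. p \<in> A \<Longrightarrow> z \<in> F \<Longrightarrow> \<exists>m\<in>I. \<delta> < \<bar>z m - p m\<bar>"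
proof -
  obtain d where d: "d > 0" "\<And>p z. p \<in> A \<Longrightarrow> z \<in> F \<Longrightarrow> d \<le> dist p z"
  proof (cases "A = {} \<or> F = {}")
    case False
    have "continuous_on A (\<lambda>p. infdist p F)" by (intro continuous_intros)
    then obtain p0 where p0: "p0 \<in> A" "\<And>p. p \<in> A \<Longrightarrow> infdist p0 F \<le> infdist p F"
      using continuous_attains_inf[OF assms(1)] False by metis
    have "infdist p0 F > 0"
      using p0(1) assms False by (intro infdist_pos_not_in_closed) auto
    then show ?thesis using p0(2) infdist_le order_trans that by meson
  qed (use that[of 1] in auto)
  \<comment> \<open>The metric is at most twice the maximum over the first coordinates plus
    \<open>(1/2)^N\<close>, so differences of at most \<open>d / 4\<close> there would give a
    distance below \<open>d\<close>.\<close>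
  obtain N where N: "(1/2)^N < d / 2" using real_arch_pow_inv[of "d/2" "1/2"] d by auto
  define I :: "nat set" where "I = from_nat ` {..N}"
  show ?thesis
  proof
    show "finite I" by (simp add: I_def)
    show "d / 4 > 0" using d by simp
    fix p z assume pz: "p \<in> A" "z \<in> F"
    show "\<exists>m\<in>I. d / 4 < \<bar>z m - p m\<bar>"
    proof (rule ccontr)
      assume "\<not> ?thesis"
      then have le: "\<bar>z m - p m\<bar> \<le> d / 4" if "m \<in> I" for m using that by force
      have "Max {dist (p (from_nat n)) (z (from_nat n)) |n. n \<le> N} \<le> d / 4"
      proof (rule Max.boundedI)
        have "{dist (p (from_nat n)) (z (from_nat n)) |n. n \<le> N}
            = (\<lambda>n. dist (p (from_nat n)) (z (from_nat n))) ` {..N}" by auto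
        then show "finite {dist (p (from_nat n)) (z (from_nat n)) |n. n \<le> N}" by simp
      qed (use le in \<open>auto simp: I_def dist_real_def abs_minus_commute\<close>)
      then have "dist p z < d" using dist_fun_le_dist_first_terms[of p z N] N by linarith
      then show False using d(2)[OF pz] by simp
    qed
  qed
qed

text \<open>The functionals are chosen so that a sequence of partial sums \<open>\<Sum>j<n. c j *\<^sub>R b j\<close> with equal
  coefficient sums cannot drift, on finitely many of them, far enough to reach the closed set
  avoided by its first member. Its limit point therefore lies in the image of the unit ball.\<close>

lemma boundedly_complete_constant_sums:
  fixes x :: "nat \<Rightarrow> 'a::banach"
  assumes pcp: "PCP TYPE('a)" and wc: "weak_Cauchy x" and x: "summing_bound C x" "C > 0"
  obtains r where "strict_mono r"
    "\<And>c t. (\<And>n. norm (\<Sum>j<n. c j *\<^sub>R x (r j)) \<le> 1) \<Longrightarrow> infinite {n. (\<Sum>j<n. c j) = t}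
      \<Longrightarrow> summable (\<lambda>j. c j *\<^sub>R x (r j))"
proof -
  define X where "X = closure (span (range x))"
  define B where "B = X \<inter> cball 0 1"
  have "bounded B" "closed B" by (auto simp: B_def X_def bounded_Int)
  obtain D where "countable D" "X \<subseteq> closure D"
    unfolding X_def by (rule closed_span_separable)
  then have D: "countable D" "B \<subseteq> closure D" by (auto simp: B_def)
  obtain g :: "nat \<Rightarrow> 'a \<Rightarrow>\<^sub>L real" where g: "\<And>i j. g i (x j) = (if i = j then 1 else 0)"
    using summing_bound_biorthogonal[OF x] by blast
  have "\<exists>Y. countable Y \<and> fragmented_by Y (inverse (real (Suc n))) B" for n
  proof -
    have "inverse (real (Suc n)) > 0" by simp
    from PCP_fragmented_by_countable[OF pcp \<open>bounded B\<close> this D] show ?thesis by blast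
  qed
  then obtain Y where Y: "\<And>n. countable (Y n)" "\<And>n. fragmented_by (Y n) (inverse (real (Suc n))) B"
    by metis
  \<comment> \<open>The functionals \<open>g\<close> join those from fragmentation, so that a limit
    in the sequence space also determines the coefficients with respect to \<open>x\<close>.\<close>
  define y where "y = from_nat_into (range g \<union> (\<Union>n. Y n))"
  have y: "range y = range g \<union> (\<Union>n. Y n)"
    unfolding y_def using Y(1) by (intro range_from_nat_into) auto
  have "fragmented_by (range y) \<epsilon> B" if pos: "\<epsilon> > 0" for \<epsilon>
  proof -
    obtain n where "inverse (real (Suc n)) < \<epsilon>" using reals_Archimedean[OF pos] by blast
    then have "fragmented_by (Y n) \<epsilon> B"
      using Y(2)[of n] unfolding fragmented_by_def by (meson less_imp_le order_trans)
    then show ?thesis by (rule fragmented_by_mono) (auto simp: y)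
  qed
  then interpret countably_fragmented y B
    using \<open>closed B\<close> by unfold_locales
  obtain F where F: "\<And>n. closed (F n)" "\<And>n. F n \<subseteq> F (Suc n)" "\<Union>(range F) = - evals ` B"
    using complement_of_image_fsigma unfolding fsigma_in_ascending by auto
  \<comment> \<open>The bound \<open>2 * C\<close> is the one that
    \<open>summing_bound_coeff\<close> gives for the coefficients of partial sums in the unit
    ball.\<close>
  define K where "K l = {\<Sum>j<length l. c j *\<^sub>R x (l ! j) | c. \<forall>j<length l. \<bar>c j\<bar> \<le> 2 * C} \<inter> cball 0 1"
    for l
  have KB: "K l \<subseteq> B" for l
  proof -
    have "(\<Sum>j<length l. c j *\<^sub>R x (l ! j)) \<in> span (range x)" for c :: "nat \<Rightarrow> real"
      by (intro span_sum span_scale span_base) auto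
    then show ?thesis using closure_subset by (fastforce simp: K_def B_def X_def)
  qed
  have "\<exists>I \<delta>. finite I \<and> \<delta> > 0 \<and> (\<forall>p\<in>evals ` K l. \<forall>z\<in>F (length l). \<exists>m\<in>I. \<delta> < \<bar>z m - p m\<bar>)" for l
  proof -
    have "compact (evals ` K l)"
      unfolding K_def
      by (intro compact_continuous_image continuous_evals compact_Int_closed compact_bounded_combinations) auto
    moreover have "evals ` K l \<inter> F (length l) = {}" using KB[of l] F(3) by blast
    ultimately show ?thesis
      using compact_closed_coordinate_gap[OF _ F(1)] by metis
  qed
  then obtain I \<delta> where I: "\<And>l. finite (I l)" and \<delta>: "\<And>l. \<delta> l > 0"
    and gap: "\<And>l p z. p \<in> evals ` K l \<Longrightarrow> z \<in> F (length l) \<Longrightarrow> \<exists>m\<in>I l. \<delta> l < \<bar>z m - p m\<bar>"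
    by metis
  \<comment> \<open>Dividing by \<open>2 * C\<close> offsets the coefficient bound in the tail
    estimate. The minimum makes the drift respect the gap and also tend to zero.\<close>
  define \<eta> where "\<eta> l = min (\<delta> l) 1 / (2 * C)" for l
  have \<eta>: "\<eta> l > 0" for l using \<delta>[of l] x(2) by (simp add: \<eta>_def)
  define \<phi> where "\<phi> f = lim (\<lambda>j. blinfun_apply f (x j))" for f :: "'a \<Rightarrow>\<^sub>L real"
  have \<phi>: "(\<lambda>j. blinfun_apply f (x j)) \<longlonglongrightarrow> \<phi> f" for f
    using wc by (auto simp: \<phi>_def weak_Cauchy_def convergent_LIMSEQ_iff)
  \<comment> \<open>Besides the coordinates witnessing the gap, the first coordinates up to
    \<open>length l\<close> are controlled, so every coordinate is controlled from some stage
    on.\<close>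
  define P where "P l j i \<longleftrightarrow> (\<forall>m\<in>I l \<union> {..length l}.
      \<bar>blinfun_apply (y m) (x i) - \<phi> (y m)\<bar> \<le> \<eta> l * (1/2)^(Suc j))" for l j i
  have "\<forall>\<^sub>F i in sequentially. P l j i" for l j
    unfolding P_def
  proof (intro eventually_ball_finite ballI)
    fix m
    have "\<eta> l * (1/2)^(Suc j) > 0" using \<eta> by simp
    from tendstoD[OF \<phi> this, of "y m"]
    show "\<forall>\<^sub>F i in sequentially. \<bar>blinfun_apply (y m) (x i) - \<phi> (y m)\<bar> \<le> \<eta> l * (1/2)^(Suc j)"
      by eventually_elim (simp add: dist_real_def)
  qed (use I in auto)
  then obtain r where r: "strict_mono r" "\<And>k j. k \<le> j \<Longrightarrow> P (map r [0..<k]) j (r j)"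
    using diagonal_selection[of P] by blast
  have br: "summing_bound C (x \<circ> r)" by (rule summing_bound_subseq[OF x(1) r(1)])
  have "summable (\<lambda>j. c j *\<^sub>R x (r j))"
    if c: "\<And>n. norm (\<Sum>j<n. c j *\<^sub>R x (r j)) \<le> 1" and inf: "infinite {n. (\<Sum>j<n. c j) = t}" for c t
  proof -
    define s where "s n = (\<Sum>j<n. c j *\<^sub>R x (r j))" for n
    define \<sigma> where "\<sigma> n = (\<Sum>j<n. c j)" for n
    have cC: "\<bar>c j\<bar> \<le> 2 * C" for j
    proof -
      have "\<bar>c j\<bar> \<le> 2 * C * norm (s (Suc j))"
        using summing_bound_coeff[OF br, of j "Suc j" c] by (simp add: s_def)
      also have "\<dots> \<le> 2 * C * 1" using c[of "Suc j"] x(2) by (intro mult_left_mono) (auto simp: s_def)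
      finally show ?thesis by simp
    qed
    define l where "l k = map r [0..<k]" for k
    \<comment> \<open>Equal coefficient sums at \<open>k\<close> and \<open>n\<close> remove the
      term with \<phi> from the tail estimate.\<close>
    have drift: "\<bar>y m (s n) - y m (s k)\<bar> \<le> min (\<delta> (l k)) 1 * (1/2)^k"
      if "k \<le> n" "\<sigma> k = \<sigma> n" "m \<in> I (l k) \<union> {..k}" for k n m
    proof -
      have "\<bar>y m (s n) - y m (s k) - (\<sigma> n - \<sigma> k) * \<phi> (y m)\<bar> \<le> 2 * C * (\<eta> (l k) * (1/2)^k)"
        unfolding s_def \<sigma>_def
      proof (rule blinfun_tail_estimate[OF that(1)])
        show "\<bar>y m (x (r j)) - \<phi> (y m)\<bar> \<le> \<eta> (l k) * (1/2)^(Suc j)" if "k \<le> j" for j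
          using r(2)[OF that] \<open>m \<in> I (l k) \<union> {..k}\<close> by (auto simp: P_def l_def)
      qed (use cC x(2) \<eta> in \<open>auto intro: less_imp_le\<close>)
      then show ?thesis using that(2) x(2) by (simp add: \<eta>_def)
    qed
    obtain u :: "nat \<Rightarrow> nat" where "strict_mono u" "\<forall>i. u i \<in> {n. (\<Sum>j<n. c j) = t}"
      using infinite_enumerate[OF inf] by blast
    then have u: "strict_mono u" "\<And>i. \<sigma> (u i) = t" by (simp_all add: \<sigma>_def)
    have ui: "i \<le> u i" for i using u(1) by (rule seq_suble)
    have umono: "u i \<le> u j" if "i \<le> j" for i j using u(1) that by (simp add: strict_mono_less_eq)
    have "convergent (\<lambda>i. y m (s (u i)))" for m
    proof -
      have "Cauchy (\<lambda>i. y m (s (u i)))"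
      proof (rule metric_CauchyI)
        fix e :: real assume "e > 0"
        then obtain n where n: "(1/2)^n < e / 2" using real_arch_pow_inv[of "e/2" "1/2"] by auto
        define M where "M = max n m"
        have near: "\<bar>y m (s (u i)) - y m (s (u M))\<bar> < e / 2" if "i \<ge> M" for i
        proof -
          have "m \<in> I (l (u M)) \<union> {..u M}" using ui[of M] by (simp add: M_def)
          then have "\<bar>y m (s (u i)) - y m (s (u M))\<bar> \<le> min (\<delta> (l (u M))) 1 * (1/2)^(u M)"
            using umono[OF that] u(2) by (intro drift) auto
          also have "\<dots> \<le> 1 * (1/2)^n"
            using ui[of M] \<delta>[of "l (u M)"] by (intro mult_mono power_decreasing) (auto simp: M_def)
          finally show ?thesis using n by simp
        qed
        have "dist (y m (s (u i))) (y m (s (u j))) < e" if "i \<ge> M" "j \<ge> M" for i j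
          using near[OF that(1)] near[OF that(2)] unfolding dist_real_def by linarith
        then show "\<exists>M. \<forall>i\<ge>M. \<forall>j\<ge>M. dist (y m (s (u i))) (y m (s (u j))) < e" by blast
      qed
      then show ?thesis by (rule Cauchy_convergent)
    qed
    then obtain z where z: "\<And>m. (\<lambda>i. y m (s (u i))) \<longlonglongrightarrow> z m"
      unfolding convergent_def by metis
    \<comment> \<open>Membership would force \<open>z\<close> to differ from
      \<open>evals (s (u k))\<close> by more than the gap in a controlled coordinate, while the
      drift bound passes to the limit.\<close>
    have "z \<notin> F (u k)" for k
    proof
      assume "z \<in> F (u k)"
      have "s (u k) \<in> K (l (u k))"
        unfolding K_def using cC c[of "u k"] by (auto simp: s_def l_def intro!: exI[of _ c])
      then have "evals (s (u k)) \<in> evals ` K (l (u k))" by blast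
      then obtain m where m: "m \<in> I (l (u k))" "\<delta> (l (u k)) < \<bar>z m - evals (s (u k)) m\<bar>"
        using gap \<open>z \<in> F (u k)\<close> by (metis l_def length_map length_upt minus_nat.diff_0)
      have "\<bar>z m - y m (s (u k))\<bar> \<le> \<delta> (l (u k))"
      proof (rule LIMSEQ_le_const2)
        show "(\<lambda>i. \<bar>y m (s (u i)) - y m (s (u k))\<bar>) \<longlonglongrightarrow> \<bar>z m - y m (s (u k))\<bar>"
          by (intro tendsto_intros z)
        have "\<bar>y m (s (u i)) - y m (s (u k))\<bar> \<le> \<delta> (l (u k))" if "i \<ge> k" for i
        proof -
          have "\<bar>y m (s (u i)) - y m (s (u k))\<bar> \<le> min (\<delta> (l (u k))) 1 * (1/2)^(u k)"
            using umono[OF that] u(2) m(1) by (intro drift) auto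
          also have "\<dots> \<le> \<delta> (l (u k)) * 1"
            using \<delta>[of "l (u k)"] by (intro mult_mono) (auto simp: power_le_one)
          finally show ?thesis by simp
        qed
        then show "\<exists>N. \<forall>i\<ge>N. \<bar>y m (s (u i)) - y m (s (u k))\<bar> \<le> \<delta> (l (u k))" by blast
      qed
      then show False using m(2) by (simp add: evals_def)
    qed
    \<comment> \<open>The indices \<open>u k\<close> suffice to avoid every \<open>F i\<close>,
      since the sets increase and \<open>i \<le> u i\<close>.\<close>
    moreover have "F i \<subseteq> F (u i)" for i using lift_Suc_mono_le[of F, OF F(2) ui] .
    ultimately have "z \<in> evals ` B" using F(3) by blast
    then obtain w where w: "w \<in> B" "z = evals w" by blast
    have gw: "g i w = spread r c i" for i
    proof -
      obtain m where m: "g i = y m" using y by (metis UnI1 rangeE rangeI)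
      have "(\<lambda>k. g i (s (u k))) \<longlonglongrightarrow> g i w" using z[of m] w(2) by (simp add: m evals_def)
      moreover have "g i (s n) = spread r c i" if "n > i" for n
      proof -
        have "i < r n" using that seq_suble[OF r(1), of n] by simp
        have "g i (s n) = g i (\<Sum>j<r n. spread r c j *\<^sub>R x j)"
          unfolding s_def by (subst sum_spread[OF r(1)]) simp
        also have "\<dots> = (\<Sum>j<r n. if j = i then spread r c i else 0)"
          by (simp only: blinfun.sum_right blinfun.scaleR_right g) (intro sum.cong, auto)
        also have "\<dots> = spread r c i" using \<open>i < r n\<close> by simp
        finally show ?thesis .
      qed
      then have "\<forall>\<^sub>F k in sequentially. g i (s (u k)) = spread r c i"
        using ui by (intro eventually_sequentiallyI[of "Suc i"]) (meson Suc_le_lessD less_le_trans)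
      then have "(\<lambda>k. g i (s (u k))) \<longlonglongrightarrow> spread r c i" by (rule tendsto_eventually)
      ultimately show ?thesis by (rule LIMSEQ_unique)
    qed
    have "(\<lambda>i. g i w *\<^sub>R x i) sums w"
      using w(1) by (intro summing_bound_expansion[OF x g]) (auto simp: B_def X_def)
    then have "(\<lambda>n. \<Sum>i<n. spread r c i *\<^sub>R x i) \<longlonglongrightarrow> w" by (simp add: gw sums_def)
    \<comment> \<open>The expansion of \<open>w\<close> along all of \<open>x\<close> converges;
      cutting it at the indices \<open>r n\<close> gives convergence of every partial sum of
      \<open>c\<close>, not only of those along \<open>u\<close>.\<close>
    from LIMSEQ_subseq_LIMSEQ[OF this r(1)]
    have "(\<lambda>n. \<Sum>j<n. c j *\<^sub>R x (r j)) \<longlonglongrightarrow> w" by (simp add: o_def sum_spread[OF r(1)])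
    then show ?thesis by (auto simp: summable_def sums_def)
  qed
  then show ?thesis using r(1) that by blast
qed

text \<open>A bounded sequence of partial sums is perturbed by an absolutely convergent series on a sparse
  set of indices so that the coefficient sums hit one of their cluster points infinitely often.\<close>

lemma boundedly_complete_if_constant_sums:
  fixes b :: "nat \<Rightarrow> 'a::banach"
  assumes b: "summing_bound C b" and L: "\<And>j. norm (b j) \<le> L"
    and const: "\<And>c t. (\<And>n. norm (\<Sum>j<n. c j *\<^sub>R b j) \<le> 1) \<Longrightarrow> infinite {n. (\<Sum>j<n. c j) = t}
      \<Longrightarrow> summable (\<lambda>j. c j *\<^sub>R b j)"
  shows "boundedly_complete b"
  unfolding boundedly_complete_def
proof (intro allI impI)
  fix c :: "nat \<Rightarrow> real"
  assume "bdd_above (range (\<lambda>n. norm (\<Sum>j<n. c j *\<^sub>R b j)))"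
  then obtain M where M: "\<And>n. norm (\<Sum>j<n. c j *\<^sub>R b j) \<le> M" by (auto simp: bdd_above_def)
  define \<sigma> where "\<sigma> n = (\<Sum>j<n. c j)" for n
  have "\<bar>\<sigma> n\<bar> \<le> \<bar>C\<bar> * M" for n
  proof -
    have "\<bar>\<sigma> n\<bar> \<le> C * norm (\<Sum>j<n. c j *\<^sub>R b j)"
      unfolding \<sigma>_def by (rule summing_boundD(2)[OF b]) simp
    also have "\<dots> \<le> \<bar>C\<bar> * M" using M by (intro mult_mono) auto
    finally show ?thesis .
  qed
  then have "bounded (range \<sigma>)" by (auto simp: bounded_iff)
  then obtain t h where h: "strict_mono h" "(\<sigma> \<circ> h) \<longlonglongrightarrow> t"
    using bounded_imp_convergent_subsequence by blast
  \<comment> \<open>The condition \<open>1 \<le> i\<close> makes the cut-offs \<open>k j\<close>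
    positive, so that each has a preceding index at which a correction can be placed.\<close>
  define P where "P l j i \<longleftrightarrow> \<bar>\<sigma> (h i) - t\<bar> \<le> (1/2)^j \<and> 1 \<le> i" for l :: "nat list" and j i :: nat
  have "\<forall>\<^sub>F i in sequentially. P l j i" for l j
  proof -
    have "(1/2 :: real)^j > 0" by simp
    from tendstoD[OF h(2) this] have "\<forall>\<^sub>F i in sequentially. \<bar>\<sigma> (h i) - t\<bar> \<le> (1/2)^j"
      by eventually_elim (simp add: dist_real_def)
    then show ?thesis unfolding P_def using eventually_ge_at_top by (rule eventually_conj)
  qed
  then obtain q where q: "strict_mono q" "\<And>k j. k \<le> j \<Longrightarrow> P (map q [0..<k]) j (q j)"
    using diagonal_selection[of P] by blast
  define k where "k = h \<circ> q"
  have "strict_mono k" using h(1) q(1) by (simp add: k_def strict_mono_o)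
  have k1: "k j \<ge> 1" for j using q(2)[of 0 j] seq_suble[OF h(1), of "q j"] by (simp add: P_def k_def)
  have kt: "\<bar>\<sigma> (k j) - t\<bar> \<le> (1/2)^j" for j using q(2)[of 0 j] by (simp add: P_def k_def)
  \<comment> \<open>The correction sits at the last index that contributes to
    \<open>\<sigma> (k j)\<close>.\<close>
  define p where "p j = k j - 1" for j
  have kp: "k j = Suc (p j)" for j using k1[of j] by (simp add: p_def)
  have p: "strict_mono p" using \<open>strict_mono k\<close> by (auto simp: strict_mono_def kp)
  \<comment> \<open>The corrections telescope: those placed up to the cut-off \<open>k n\<close> add
    up to the defect \<open>t - \<sigma> (k n)\<close>, and their sizes decay geometrically.\<close>
  define D where "D i = (case i of 0 \<Rightarrow> t - \<sigma> (k 0) | Suc i \<Rightarrow> \<sigma> (k i) - \<sigma> (k (Suc i)))" for i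
  have sumD: "(\<Sum>i\<le>n. D i) = t - \<sigma> (k n)" for n
    by (induction n) (auto simp: D_def)
  have D: "\<bar>D i\<bar> \<le> 4 * (1/2)^i" for i
  proof (cases i)
    case 0
    then show ?thesis using kt[of 0] by (simp add: D_def abs_minus_commute)
  next
    case (Suc n)
    have "(1/2 :: real)^n \<ge> 0" by simp
    moreover have "4 * (1/2 :: real)^i = 2 * (1/2)^n" "(1/2 :: real)^(Suc n) \<le> (1/2)^n" by (simp_all add: Suc)
    moreover have "D i = \<sigma> (k n) - \<sigma> (k (Suc n))" by (simp add: D_def Suc)
    ultimately show ?thesis using kt[of n] kt[of "Suc n"] by linarith
  qed
  define d where "d = spread p D"
  have "summable (\<lambda>i. D i *\<^sub>R b (p i))"
  proof (rule summable_comparison_test'[where N = 0])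
    show "summable (\<lambda>i. 4 * (1/2)^i * L :: real)"
      by (intro summable_mult summable_mult2 summable_geometric) simp
    show "norm (D i *\<^sub>R b (p i)) \<le> 4 * (1/2)^i * L" for i
      using D[of i] L[of "p i"] by (simp only: norm_scaleR real_norm_def) (intro mult_mono, auto)
  qed
  then have "summable (\<lambda>i. d (p i) *\<^sub>R b (p i))" by (simp add: d_def p)
  then have sd: "summable (\<lambda>j. d j *\<^sub>R b j)"
    using summable_mono_reindex[OF p, of "\<lambda>j. d j *\<^sub>R b j"] by (simp add: d_def spread_def)
  define e where "e j = c j + d j" for j
  have "Bseq (\<lambda>n. \<Sum>j<n. d j *\<^sub>R b j)"
    using sd by (simp add: summable_iff_convergent convergent_imp_Bseq)
  then obtain K where K: "\<And>n. norm (\<Sum>j<n. d j *\<^sub>R b j) \<le> K" by (auto simp: Bseq_def)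
  \<comment> \<open>Division by \<open>R\<close> brings the corrected partial sums into the unit
    ball; the summand 1 keeps \<open>R\<close> positive.\<close>
  define R where "R = \<bar>M\<bar> + \<bar>K\<bar> + 1"
  have R: "R > 0" "norm (\<Sum>j<n. e j *\<^sub>R b j) \<le> R" for n
    using M[of n] K[of n] norm_triangle_ineq[of "\<Sum>j<n. c j *\<^sub>R b j" "\<Sum>j<n. d j *\<^sub>R b j"]
    by (auto simp: R_def e_def scaleR_left_distrib sum.distrib)
  have "summable (\<lambda>j. (e j / R) *\<^sub>R b j)"
  proof (rule const)
    show "norm (\<Sum>j<n. (e j / R) *\<^sub>R b j) \<le> 1" for n
    proof -
      have "(\<Sum>j<n. (e j / R) *\<^sub>R b j) = (1 / R) *\<^sub>R (\<Sum>j<n. e j *\<^sub>R b j)"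
        by (simp add: scaleR_right.sum)
      then show ?thesis using R by (simp add: field_simps)
    qed
    have "(\<Sum>j<k n. e j / R) = t / R" for n
    proof -
      \<comment> \<open>Since \<open>k n = Suc (p n)\<close>, the correction \<open>D n\<close> is
        included in the sum below \<open>k n\<close>.\<close>
      have "(\<Sum>j<k n. d j) = (\<Sum>i<n. D i) + D n"
        using sum_spread[OF p, where c = D and n = n and v = "\<lambda>_. 1 :: real"] by (simp add: kp d_def p)
      also have "\<dots> = t - \<sigma> (k n)" using sumD[of n] by (simp add: lessThan_Suc_atMost[symmetric])
      finally show ?thesis by (simp add: e_def \<sigma>_def sum.distrib flip: sum_divide_distrib)
    qed
    then have "range k \<subseteq> {n. (\<Sum>j<n. e j / R) = t / R}" by auto
    moreover have "infinite (range k)"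
      using \<open>strict_mono k\<close> by (simp add: range_inj_infinite strict_mono_imp_inj_on)
    ultimately show "infinite {n. (\<Sum>j<n. e j / R) = t / R}" using finite_subset by blast
  qed
  then have "summable (\<lambda>j. R *\<^sub>R ((e j / R) *\<^sub>R b j))" by (rule summable_scaleR_right)
  then have "summable (\<lambda>j. e j *\<^sub>R b j)" using R(1) by simp
  from summable_diff[OF this sd] show "summable (\<lambda>j. c j *\<^sub>R b j)"
    by (simp add: e_def scaleR_left_distrib)
qed

theorem theorem5p1:
  fixes x :: "nat \<Rightarrow> 'a::banach"
  assumes "PCP TYPE('a)"
    and "nontrivial_weak_Cauchy x"
  shows "\<exists>r. strict_mono r \<and> basic_sequence (x \<circ> r) \<and> boundedly_complete (x \<circ> r) \<and>
           s_sequence (x \<circ> r)"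
proof -
  have wc: "weak_Cauchy x" using assms(2) by (simp add: nontrivial_weak_Cauchy_def)
  have wc_sub: "weak_Cauchy (x \<circ> r)" if "strict_mono r" for r
    using wc that convergent_subseq_convergent unfolding weak_Cauchy_def by (fastforce simp: o_def)
  obtain q C where q: "strict_mono q" "C > 0" "summing_bound C (x \<circ> q)"
    using summing_bound_subsequence_exists[OF assms(2)] by blast
  obtain r where r: "strict_mono r"
    "\<And>c t. (\<And>n. norm (\<Sum>j<n. c j *\<^sub>R (x \<circ> q) (r j)) \<le> 1) \<Longrightarrow> infinite {n. (\<Sum>j<n. c j) = t}
      \<Longrightarrow> summable (\<lambda>j. c j *\<^sub>R (x \<circ> q) (r j))"
    using boundedly_complete_constant_sums[OF assms(1) wc_sub[OF q(1)] q(3,2)] by blast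
  obtain L where "\<And>j. norm (x j) \<le> L" using weak_Cauchy_imp_bounded[OF wc] by blast
  \<comment> \<open>The bound obtained for the first subsequence survives the second selection, so
    the final subsequence has it together with bounded completeness.\<close>
  have b: "summing_bound C (x \<circ> (q \<circ> r))"
    using summing_bound_subseq[OF q(3) r(1)] by (simp add: o_assoc)
  have "boundedly_complete (x \<circ> (q \<circ> r))"
  proof (rule boundedly_complete_if_constant_sums[OF b])
    show "norm ((x \<circ> (q \<circ> r)) j) \<le> L" for j using \<open>\<And>j. norm (x j) \<le> L\<close> by simp
  qed (use r(2) in simp)
  moreover have "basic_sequence (x \<circ> (q \<circ> r))" by (rule summing_bound_basic[OF b q(2)])
  moreover have "strict_mono (q \<circ> r)" using q(1) r(1) by (rule strict_mono_o)
  ultimately show ?thesis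
    using wc_sub summing_bound_dominates[OF b] unfolding s_sequence_def by blast
qed

end
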